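(* For every integer $i\ge1$: if $i=1$ then $J(3i,2i-1)=J(3,1)=4$, and if $i\ge2$ then \[ J(3i,\,2i-1)=\binom{2i-2}{i}\cdot\frac{9i^2+3i-4}{2(i-1)}. \]
   Context: Let $\pi=\pi_1\cdots\pi_n$ be a permutation of $[n]$. An entry $\pi_i$ is a left-to-right minimum if $\pi_j>\pi_i$ for all $j<i$. Let the left-to-right minima of $\pi$ be at positions $k_1<k_2<\dots<k_a$ (so $\pi_{k_1}>\dots>\pi_{k_a}$), and set $\pi_{k_0}:=n+1$ and $k_{a+1}:=n+1$. The staircase grid $B_a$ consists of the boxes $(i,j)$ with $1\le i\le j\le a$, where $i$ is the row index counted from the top and $j$ is the column index counted from the left. The staircase encoding of $\pi$ fills box $(i,j)$ of $B_a$ with the number of indices $p$ with $k_j<p<k_{j+1}$ and $\pi_{k_i}<\pi_p<\pi_{k_{i-1}}$. A permutation $\pi$ contains $132$ if there are indices $p<q<r$ with $\pi_p<\pi_r<\pi_q$, and avoids $132$ otherwise. For integers $\ell\ge1$, $k\ge0$, let $J(\ell,k)$ denote the number of $132$-avoiding permutations of $[\ell]$ whose staircase encoding has exactly $k$ nonzero boxes. *)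

theory Defs
  imports Complex_Main "HOL-Combinatorics.Permutations"
begin

text \<open>A permutation of \<open>[n]\<close> is a function \<open>\<pi> :: nat \<Rightarrow> nat\<close> with \<open>\<pi> permutes {1..n}\<close>; its
  \<open>p\<close>-th entry is \<open>\<pi> p\<close>. All positions, rows and columns are counted from 1.\<close>

definition lr_min_positions :: "nat \<Rightarrow> (nat \<Rightarrow> nat) \<Rightarrow> nat set" where
  "lr_min_positions n \<pi> = {p \<in> {1..n}. \<forall>q \<in> {1..n}. q < p \<longrightarrow> \<pi> q > \<pi> p}"

definition num_lr_min :: "nat \<Rightarrow> (nat \<Rightarrow> nat) \<Rightarrow> nat" where
  "num_lr_min n \<pi> = card (lr_min_positions n \<pi>)"

text \<open>\<open>lr_pos n \<pi> j\<close> is \<open>k\<^sub>j\<close> for \<open>1 \<le> j \<le> a + 1\<close>, with \<open>k\<^bsub>a+1\<^esub> = n + 1\<close>. There is no position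
  \<open>k\<^sub>0\<close>: the index 0 occurs only in the convention \<open>\<pi>\<^bsub>k\<^sub>0\<^esub> = n + 1\<close>, which is part of
  \<open>lr_val\<close>.\<close>

definition lr_pos :: "nat \<Rightarrow> (nat \<Rightarrow> nat) \<Rightarrow> nat \<Rightarrow> nat" where
  "lr_pos n \<pi> j =
     (if j = num_lr_min n \<pi> + 1 then n + 1
      else sorted_list_of_set (lr_min_positions n \<pi>) ! (j - 1))"

definition lr_val :: "nat \<Rightarrow> (nat \<Rightarrow> nat) \<Rightarrow> nat \<Rightarrow> nat" where
  "lr_val n \<pi> i = (if i = 0 then n + 1 else \<pi> (lr_pos n \<pi> i))"

definition staircase_grid :: "nat \<Rightarrow> (nat \<times> nat) set" where
  "staircase_grid a = {(i, j). 1 \<le> i \<and> i \<le> j \<and> j \<le> a}"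

text \<open>The values of \<open>staircase_encoding n \<pi>\<close> are meaningful only on the boxes of
  \<open>staircase_grid (num_lr_min n \<pi>)\<close>.\<close>

definition staircase_encoding :: "nat \<Rightarrow> (nat \<Rightarrow> nat) \<Rightarrow> nat \<times> nat \<Rightarrow> nat" where
  "staircase_encoding n \<pi> = (\<lambda>(i, j).
     card {p \<in> {1..n}. lr_pos n \<pi> j < p \<and> p < lr_pos n \<pi> (j + 1) \<and>
                       lr_val n \<pi> i < \<pi> p \<and> \<pi> p < lr_val n \<pi> (i - 1)})"

definition contains_132 :: "nat \<Rightarrow> (nat \<Rightarrow> nat) \<Rightarrow> bool" where
  "contains_132 n \<pi> \<longleftrightarrow>
     (\<exists>p \<in> {1..n}. \<exists>q \<in> {1..n}. \<exists>r \<in> {1..n}. p < q \<and> q < r \<and> \<pi> p < \<pi> r \<and> \<pi> r < \<pi> q)"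

definition avoids_132 :: "nat \<Rightarrow> (nat \<Rightarrow> nat) \<Rightarrow> bool" where
  "avoids_132 n \<pi> \<longleftrightarrow> \<not> contains_132 n \<pi>"

definition nonzero_boxes :: "nat \<Rightarrow> (nat \<Rightarrow> nat) \<Rightarrow> (nat \<times> nat) set" where
  "nonzero_boxes n \<pi> =
     {b \<in> staircase_grid (num_lr_min n \<pi>). staircase_encoding n \<pi> b \<noteq> 0}"

definition J :: "nat \<Rightarrow> nat \<Rightarrow> nat" where
  "J l k = card {\<pi>. \<pi> permutes {1..l} \<and> avoids_132 l \<pi> \<and> card (nonzero_boxes l \<pi>) = k}"

end

theory Submission
  imports Defs "HOL-Computational_Algebra.Formal_Power_Series"
begin

text \<open>
  Cutting a 132-avoider at its maximum, \<open>\<pi> = \<sigma> n \<tau>\<close> with every entry of \<open>\<sigma>\<close> above every entry of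
  \<open>\<tau>\<close>, identifies 132-avoiders with binary trees. The nonzero boxes of \<open>\<pi>\<close> are those of \<open>\<sigma>\<close> and
  \<open>\<tau>\<close>, and, when \<open>\<sigma>\<close> is nonempty, the box that receives the maximum (top row, last column of
  \<open>\<sigma>\<close>), which is new unless \<open>\<sigma>\<close> has at least two entries and ends in its own maximum.

  Count trees by size and by the excess \<open>2 \<cdot> size - 3 \<cdot> boxes\<close>, which is positive on nonempty
  trees. The case \<open>(3i, 2i-1)\<close> is exactly excess 3, and the quadratic equation of the
  generating function determines the parts \<open>D\<^sub>1\<close>, \<open>D\<^sub>2\<close>, \<open>D\<^sub>3\<close> of excess 1, 2, 3 one after
  another. With \<open>s = 1 - 2xD\<^sub>1\<close> one gets \<open>s\<^sup>2 = 1 - 4x\<^sup>3\<close> and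
  \<open>D\<^sub>3 = (1 - s)/s + x\<^sup>3(9 - s\<^sup>2)/(4s\<^sup>3)\<close>, whose coefficients come from \<open>1/s\<close>, the generating function
  of the central binomial coefficients, and its derivative.
\<close>

section \<open>Nonzero boxes via left-to-right minima\<close>

text \<open>The box of an entry that is not a left-to-right minimum is recorded by the position of the
  minimum bounding its row from below and by the value of the minimum opening its column.\<close>

definition record_box :: "(nat \<Rightarrow> nat) \<Rightarrow> nat \<Rightarrow> nat \<times> nat" where
  "record_box \<pi> p = ((LEAST q. 0 < q \<and> \<pi> q < \<pi> p), Min (\<pi> ` {1..p}))"

definition record_boxes :: "nat \<Rightarrow> (nat \<Rightarrow> nat) \<Rightarrow> (nat \<times> nat) set" where
  "record_boxes n \<pi> = record_box \<pi> ` {p \<in> {1..n}. \<exists>q. 0 < q \<and> q < p \<and> \<pi> q < \<pi> p}"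

section \<open>Left-to-right minima, and the passage from boxes to recorded boxes\<close>

context
  fixes n :: nat and \<pi> :: "nat \<Rightarrow> nat"
  assumes perm: "\<pi> permutes {1..n}"
begin

lemma lr_min_finite: "finite (lr_min_positions n \<pi>)"
  by (simp add: lr_min_positions_def)

lemma lr_pos_mem:
  assumes "1 \<le> j" "j \<le> num_lr_min n \<pi>"
  shows "lr_pos n \<pi> j \<in> lr_min_positions n \<pi>"
proof -
  have "sorted_list_of_set (lr_min_positions n \<pi>) ! (j - 1) \<in> set (sorted_list_of_set (lr_min_positions n \<pi>))"
    using assms lr_min_finite by (intro nth_mem) (auto simp: num_lr_min_def)
  then show ?thesis
    using assms lr_min_finite by (simp add: lr_pos_def)
qed

lemma lr_pos_surj:
  assumes "p \<in> lr_min_positions n \<pi>"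
  obtains j where "1 \<le> j" "j \<le> num_lr_min n \<pi>" "lr_pos n \<pi> j = p"
proof -
  have "p \<in> set (sorted_list_of_set (lr_min_positions n \<pi>))"
    using assms lr_min_finite by simp
  then obtain i where i: "i < num_lr_min n \<pi>" "sorted_list_of_set (lr_min_positions n \<pi>) ! i = p"
    by (auto simp: in_set_conv_nth num_lr_min_def)
  show thesis
    by (rule that[of "Suc i"]) (use i in \<open>auto simp: lr_pos_def\<close>)
qed

lemma lr_pos_less:
  assumes "1 \<le> i" "i < j" "j \<le> num_lr_min n \<pi> + 1"
  shows "lr_pos n \<pi> i < lr_pos n \<pi> j"
proof (cases "j = num_lr_min n \<pi> + 1")
  case True
  then have "lr_pos n \<pi> i \<in> lr_min_positions n \<pi>"
    using assms by (intro lr_pos_mem) auto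
  moreover have "lr_pos n \<pi> j = n + 1"
    using True by (simp add: lr_pos_def)
  ultimately show ?thesis
    by (auto simp: lr_min_positions_def)
next
  case False
  have "sorted_wrt (<) (sorted_list_of_set (lr_min_positions n \<pi>))"
    by simp
  then have "sorted_list_of_set (lr_min_positions n \<pi>) ! (i - 1)
      < sorted_list_of_set (lr_min_positions n \<pi>) ! (j - 1)"
    by (rule sorted_wrt_nth_less) (use assms False in \<open>auto simp: num_lr_min_def\<close>)
  then show ?thesis
    using assms False by (simp add: lr_pos_def)
qed

lemma lr_pos_le:
  assumes "1 \<le> i" "i \<le> j" "j \<le> num_lr_min n \<pi> + 1"
  shows "lr_pos n \<pi> i \<le> lr_pos n \<pi> j"
  using assms lr_pos_less[of i j] by (cases "i = j") auto

lemma lr_pos_less_iff: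
  assumes "1 \<le> i" "1 \<le> j" "i \<le> num_lr_min n \<pi> + 1" "j \<le> num_lr_min n \<pi> + 1"
  shows "lr_pos n \<pi> i < lr_pos n \<pi> j \<longleftrightarrow> i < j"
  using assms lr_pos_less[of i j] lr_pos_le[of j i] by (cases "i < j") auto

lemma lr_min_antimono:
  assumes "p \<in> lr_min_positions n \<pi>" "q \<in> lr_min_positions n \<pi>" "p \<le> q"
  shows "\<pi> q \<le> \<pi> p"
  using assms by (cases "p = q") (auto simp: lr_min_positions_def less_imp_le)

lemma prefix_min_position:
  assumes "q \<in> {1..n}"
  obtains m where "m \<in> lr_min_positions n \<pi>" "m \<le> q" "\<pi> m = Min (\<pi> ` {1..q})"
proof -
  have "Min (\<pi> ` {1..q}) \<in> \<pi> ` {1..q}"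
    using assms by (intro Min_in) auto
  then obtain m where m: "m \<in> {1..q}" "\<pi> m = Min (\<pi> ` {1..q})"
    by auto
  have "\<pi> m < \<pi> r" if "r \<in> {1..n}" "r < m" for r
  proof -
    have "\<pi> m \<le> \<pi> r"
      unfolding m(2) using that m(1) by (intro Min_le) auto
    moreover have "\<pi> m \<noteq> \<pi> r"
      using that permutes_inj[OF perm] by (auto dest: injD)
    ultimately show ?thesis by simp
  qed
  then have "m \<in> lr_min_positions n \<pi>"
    using m assms by (auto simp: lr_min_positions_def)
  then show thesis
    using that m by auto
qed

text \<open>The prefix minimum is itself attained at a left-to-right minimum. Lying before
  \<open>lr_pos n \<pi> (j + 1)\<close>, that one has index at most \<open>j\<close>, and values
  decrease along the minima.\<close>

lemma prefix_min_eq: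
  assumes j: "1 \<le> j" "j \<le> num_lr_min n \<pi>"
    and q: "lr_pos n \<pi> j \<le> q" "q < lr_pos n \<pi> (j + 1)" "q \<le> n"
  shows "Min (\<pi> ` {1..q}) = \<pi> (lr_pos n \<pi> j)"
proof (rule antisym)
  have J: "lr_pos n \<pi> j \<in> lr_min_positions n \<pi>"
    using j by (rule lr_pos_mem)
  then show "Min (\<pi> ` {1..q}) \<le> \<pi> (lr_pos n \<pi> j)"
    using q by (intro Min_le) (auto simp: lr_min_positions_def)
  have "q \<in> {1..n}"
    using J q by (auto simp: lr_min_positions_def)
  then obtain m where m: "m \<in> lr_min_positions n \<pi>" "m \<le> q" "\<pi> m = Min (\<pi> ` {1..q})"
    by (rule prefix_min_position)
  obtain j' where j': "1 \<le> j'" "j' \<le> num_lr_min n \<pi>" "lr_pos n \<pi> j' = m"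
    using m(1) by (rule lr_pos_surj)
  have "j' < j + 1"
    using lr_pos_less_iff[of j' "j + 1"] j j' m q by auto
  then have "m \<le> lr_pos n \<pi> j"
    using lr_pos_le[of j' j] j j' by auto
  then show "\<pi> (lr_pos n \<pi> j) \<le> Min (\<pi> ` {1..q})"
    using lr_min_antimono[OF m(1) J] m(3) by simp
qed

text \<open>Everything before the first entry below \<open>\<pi> p\<close> is at least
  \<open>\<pi> p\<close>, hence larger than that entry.\<close>

lemma first_smaller_lr_min:
  assumes "p \<in> {1..n}" "0 < q" "q < p" "\<pi> q < \<pi> p"
  shows "(LEAST q. 0 < q \<and> \<pi> q < \<pi> p) \<in> lr_min_positions n \<pi>"
proof -
  let ?m = "LEAST q. 0 < q \<and> \<pi> q < \<pi> p"
  have m: "0 < ?m \<and> \<pi> ?m < \<pi> p"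
    using assms by (intro LeastI[of "\<lambda>q. 0 < q \<and> \<pi> q < \<pi> p" q]) simp
  have "?m \<le> q"
    using assms by (intro Least_le) simp
  moreover have "\<pi> ?m < \<pi> r" if "0 < r" "r < ?m" for r
    using not_less_Least[OF that(2)] that(1) m by auto
  ultimately show ?thesis
    using m assms by (auto simp: lr_min_positions_def)
qed

lemma nonzero_box_iff:
  "(i, j) \<in> nonzero_boxes n \<pi> \<longleftrightarrow> 1 \<le> i \<and> i \<le> j \<and> j \<le> num_lr_min n \<pi> \<and>
     (\<exists>p\<in>{1..n}. lr_pos n \<pi> j < p \<and> p < lr_pos n \<pi> (j + 1) \<and>
        lr_val n \<pi> i < \<pi> p \<and> \<pi> p < lr_val n \<pi> (i - 1))"
  by (auto simp: nonzero_boxes_def staircase_grid_def staircase_encoding_def card_gt_0_iff)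

text \<open>\<open>?f\<close> names a box by the position of its row's minimum and the value of its
  column's minimum. It is injective because distinct minima differ in position and in value, and it
  sends a nonzero box to the record of any entry inside it.\<close>

lemma card_nonzero_boxes: "card (nonzero_boxes n \<pi>) = card (record_boxes n \<pi>)"
proof -
  let ?f = "\<lambda>(i, j). (lr_pos n \<pi> i, \<pi> (lr_pos n \<pi> j))"
  let ?a = "num_lr_min n \<pi>"
  have inj_pos: "i = j" if "lr_pos n \<pi> i = lr_pos n \<pi> j" "1 \<le> i" "1 \<le> j" "i \<le> ?a" "j \<le> ?a" for i j
    using that lr_pos_less[of i j] lr_pos_less[of j i] by (metis le_add1 le_trans less_irrefl nat_neq_iff)
  have "inj_on ?f (nonzero_boxes n \<pi>)"
  proof (rule inj_onI, clarify)
    fix i j i' j'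
    assume a: "(i, j) \<in> nonzero_boxes n \<pi>" "(i', j') \<in> nonzero_boxes n \<pi>"
      "lr_pos n \<pi> i = lr_pos n \<pi> i'" "\<pi> (lr_pos n \<pi> j) = \<pi> (lr_pos n \<pi> j')"
    then have "lr_pos n \<pi> j = lr_pos n \<pi> j'"
      using permutes_inj[OF perm] by (auto dest: injD)
    then show "i = i' \<and> j = j'"
      using a inj_pos[of i i'] inj_pos[of j j'] by (auto simp: nonzero_box_iff)
  qed
  moreover have "?f ` nonzero_boxes n \<pi> = record_boxes n \<pi>"
  proof (intro equalityI subsetI)
    fix b assume "b \<in> ?f ` nonzero_boxes n \<pi>"
    then obtain i j where b: "b = (lr_pos n \<pi> i, \<pi> (lr_pos n \<pi> j))"
      and "(i, j) \<in> nonzero_boxes n \<pi>"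
      by auto
    then obtain p where ij: "1 \<le> i" "i \<le> j" "j \<le> ?a" and p: "p \<in> {1..n}" "lr_pos n \<pi> j < p"
      "p < lr_pos n \<pi> (j + 1)" "lr_val n \<pi> i < \<pi> p" "\<pi> p < lr_val n \<pi> (i - 1)"
      by (auto simp: nonzero_box_iff)
    have "lr_pos n \<pi> i \<in> lr_min_positions n \<pi>"
      using ij by (intro lr_pos_mem) auto
    then have i: "0 < lr_pos n \<pi> i" "\<pi> (lr_pos n \<pi> i) < \<pi> p" "lr_pos n \<pi> i \<le> n"
      using p(4) ij by (auto simp: lr_val_def lr_min_positions_def)
    have less: "lr_pos n \<pi> i < p"
      using lr_pos_le[of i j] ij p by auto
    have "(LEAST q. 0 < q \<and> \<pi> q < \<pi> p) = lr_pos n \<pi> i"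
    proof (rule Least_equality)
      show "0 < lr_pos n \<pi> i \<and> \<pi> (lr_pos n \<pi> i) < \<pi> p"
        using i by simp
      fix q assume q: "0 < q \<and> \<pi> q < \<pi> p"
      show "lr_pos n \<pi> i \<le> q"
      proof (rule ccontr)
        \<comment> \<open>An entry before \<open>lr_pos n \<pi> i\<close> is at least some earlier
          minimum, hence at least the value bounding row \<open>i\<close> from above, which exceeds
          \<open>\<pi> p\<close>. For \<open>i = 1\<close> there is no earlier minimum.\<close>
        assume "\<not> lr_pos n \<pi> i \<le> q"
        then have qi: "q < lr_pos n \<pi> i" by simp
        then have "q \<in> {1..n}" using q i by auto
        then obtain m where m: "m \<in> lr_min_positions n \<pi>" "m \<le> q" "\<pi> m = Min (\<pi> ` {1..q})"
          by (rule prefix_min_position)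
        obtain j' where j': "1 \<le> j'" "j' \<le> ?a" "lr_pos n \<pi> j' = m"
          using m(1) by (rule lr_pos_surj)
        have "j' < i"
          using lr_pos_less_iff[of j' i] ij j' m qi by auto
        then have "i \<noteq> 1" "lr_pos n \<pi> j' \<le> lr_pos n \<pi> (i - 1)"
          using j' ij by (auto intro!: lr_pos_le)
        moreover have "lr_pos n \<pi> (i - 1) \<in> lr_min_positions n \<pi>"
          using ij \<open>i \<noteq> 1\<close> by (intro lr_pos_mem) auto
        ultimately have "\<pi> (lr_pos n \<pi> (i - 1)) \<le> \<pi> m"
          using lr_min_antimono[OF m(1)] j' by auto
        also have "\<pi> m \<le> \<pi> q"
          unfolding m(3) using q by (intro Min_le) auto
        finally show False
          using p(5) q ij \<open>i \<noteq> 1\<close> by (auto simp: lr_val_def)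
      qed
    qed
    moreover have "Min (\<pi> ` {1..p}) = \<pi> (lr_pos n \<pi> j)"
      using ij p by (intro prefix_min_eq) auto
    ultimately have "b = record_box \<pi> p"
      by (simp add: b record_box_def)
    then show "b \<in> record_boxes n \<pi>"
      using p i less by (auto simp: record_boxes_def)
  next
    fix b assume "b \<in> record_boxes n \<pi>"
    then obtain p q where p: "p \<in> {1..n}" "0 < q" "q < p" "\<pi> q < \<pi> p" "b = record_box \<pi> p"
      by (auto simp: record_boxes_def)
    let ?m = "LEAST q. 0 < q \<and> \<pi> q < \<pi> p"
    have Lm: "\<pi> ?m < \<pi> p"
      using p by (intro conjunct2[OF LeastI[of "\<lambda>q. 0 < q \<and> \<pi> q < \<pi> p" q]]) simp
    obtain i where i: "1 \<le> i" "i \<le> ?a" "lr_pos n \<pi> i = ?m"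
      using first_smaller_lr_min[OF p(1-4)] by (rule lr_pos_surj)
    obtain m where m: "m \<in> lr_min_positions n \<pi>" "m \<le> p" "\<pi> m = Min (\<pi> ` {1..p})"
      using p(1) by (rule prefix_min_position)
    obtain j where j: "1 \<le> j" "j \<le> ?a" "lr_pos n \<pi> j = m"
      using m(1) by (rule lr_pos_surj)
    have "\<pi> m \<le> \<pi> q"
      unfolding m(3) using p by (intro Min_le) auto
    then have "\<pi> m < \<pi> p" using p by simp
    then have "m < p" using m(2) by (cases "m = p") auto
    have "?m \<le> m"
      using \<open>\<pi> m < \<pi> p\<close> m by (intro Least_le) (auto simp: lr_min_positions_def)
    then have "i \<le> j"
      using lr_pos_less_iff[of j i] i j by auto
    \<comment> \<open>In the last column the bound is the sentinel \<open>n + 1\<close>; otherwise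
      the next minimum, if it came no later than \<open>p\<close>, would undercut the prefix minimum
      \<open>\<pi> m\<close>.\<close>
    have "p < lr_pos n \<pi> (j + 1)"
    proof (cases "j = ?a")
      case True
      then show ?thesis using p(1) by (simp add: lr_pos_def)
    next
      case False
      then have M: "lr_pos n \<pi> (j + 1) \<in> lr_min_positions n \<pi>" "m < lr_pos n \<pi> (j + 1)"
        using j lr_pos_less[of j "j + 1"] by (auto intro!: lr_pos_mem)
      have lt: "\<pi> (lr_pos n \<pi> (j + 1)) < \<pi> m"
        using M m(1) by (auto simp: lr_min_positions_def)
      show ?thesis
      proof (rule ccontr)
        assume "\<not> p < lr_pos n \<pi> (j + 1)"
        then have "Min (\<pi> ` {1..p}) \<le> \<pi> (lr_pos n \<pi> (j + 1))"
          using M by (intro Min_le) (auto simp: lr_min_positions_def)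
        then show False using lt m(3) by simp
      qed
    qed
    \<comment> \<open>Row 1 is bounded by the conventional value \<open>n + 1\<close>. In other rows
      the preceding minimum comes before \<open>?m\<close>, so the leastness of \<open>?m\<close>
      keeps it from being below \<open>\<pi> p\<close>.\<close>
    moreover have "\<pi> p < lr_val n \<pi> (i - 1)"
    proof (cases "i = 1")
      case True
      then show ?thesis
        using permutes_in_image[OF perm, of p] p(1) by (auto simp: lr_val_def)
    next
      case False
      then have M: "lr_pos n \<pi> (i - 1) \<in> lr_min_positions n \<pi>" "lr_pos n \<pi> (i - 1) < ?m"
        using i lr_pos_less[of "i - 1" i] by (auto intro!: lr_pos_mem)
      then have "\<not> \<pi> (lr_pos n \<pi> (i - 1)) < \<pi> p"
        using not_less_Least[OF M(2)] by (auto simp: lr_min_positions_def)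
      moreover have "lr_pos n \<pi> (i - 1) \<noteq> p"
        using M(2) \<open>?m \<le> m\<close> \<open>m < p\<close> by linarith
      then have "\<pi> (lr_pos n \<pi> (i - 1)) \<noteq> \<pi> p"
        using permutes_inj[OF perm] by (auto dest: injD)
      ultimately show ?thesis
        using False i by (auto simp: lr_val_def)
    qed
    ultimately have "(i, j) \<in> nonzero_boxes n \<pi>"
      unfolding nonzero_box_iff using i j p(1) \<open>i \<le> j\<close> \<open>m < p\<close> Lm
      by (intro conjI bexI[of _ p]) (auto simp: lr_val_def)
    moreover have "b = ?f (i, j)"
      using i j m p(5) by (simp add: record_box_def)
    ultimately show "b \<in> ?f ` nonzero_boxes n \<pi>"
      by blast
  qed
  ultimately show ?thesis
    by (metis card_image)
qed

end

section \<open>Decomposition at the maximum\<close>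

text \<open>The left block is raised by \<open>r\<close> and the maximum follows it. The first and
  last cases fix all arguments outside \<open>{1..Suc (l + r)}\<close>, as \<open>permutes\<close>
  demands.\<close>

definition skew_join :: "nat \<Rightarrow> nat \<Rightarrow> (nat \<Rightarrow> nat) \<Rightarrow> (nat \<Rightarrow> nat) \<Rightarrow> nat \<Rightarrow> nat" where
  "skew_join l r \<sigma> \<tau> p =
     (if p = 0 then 0 else if p \<le> l then \<sigma> p + r else if p = Suc l then Suc (l + r)
      else if p \<le> Suc (l + r) then \<tau> (p - Suc l) else p)"

lemma permutes_interval_bounds:
  fixes \<sigma> :: "nat \<Rightarrow> nat"
  assumes "\<sigma> permutes {1..n}" "0 < p" "p \<le> n"
  shows "0 < \<sigma> p" "\<sigma> p \<le> n"
  using permutes_in_image[OF assms(1), of p] assms by auto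

text \<open>The right block is listed for two forms of the index because \<open>simp\<close>
  rewrites \<open>Suc l + q\<close> to \<open>Suc (l + q)\<close>.\<close>

lemma skew_join_simps:
  "0 < p \<Longrightarrow> p \<le> l \<Longrightarrow> skew_join l r \<sigma> \<tau> p = \<sigma> p + r"
  "skew_join l r \<sigma> \<tau> (Suc l) = Suc (l + r)"
  "0 < q \<Longrightarrow> q \<le> r \<Longrightarrow> skew_join l r \<sigma> \<tau> (Suc l + q) = \<tau> q"
  "0 < q \<Longrightarrow> q \<le> r \<Longrightarrow> skew_join l r \<sigma> \<tau> (Suc (l + q)) = \<tau> q"
  by (auto simp: skew_join_def)

lemma skew_join_position_cases:
  assumes "0 < p" "p \<le> Suc (l + r)"
  obtains (left) "p \<le> l" | (top) "p = Suc l" | (right) q where "0 < q" "q \<le> r" "p = Suc l + q"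
proof -
  consider "p \<le> l" | "p = Suc l" | "p > Suc l" by linarith
  then show thesis
    using assms right[of "p - Suc l"] left top by cases auto
qed

lemma skew_join_permutes:
  assumes \<sigma>: "\<sigma> permutes {1..l}" and \<tau>: "\<tau> permutes {1..r}"
  shows "skew_join l r \<sigma> \<tau> permutes {1..Suc (l + r)}"
proof (rule bij_imp_permutes)
  let ?\<pi> = "skew_join l r \<sigma> \<tau>"
  show "?\<pi> p = p" if "p \<notin> {1..Suc (l + r)}" for p
    using that by (auto simp: skew_join_def)
  have "inj_on ?\<pi> {1..Suc (l + r)}"
  proof (rule inj_onI)
    fix p q assume "p \<in> {1..Suc (l + r)}" "q \<in> {1..Suc (l + r)}" and eq: "?\<pi> p = ?\<pi> q"
    then have p: "0 < p" "p \<le> Suc (l + r)" and q: "0 < q" "q \<le> Suc (l + r)" by auto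
    from p show "p = q"
    proof (cases rule: skew_join_position_cases)
      case pl: left
      from q show ?thesis
      proof (cases rule: skew_join_position_cases)
        case left
        then have "\<sigma> p = \<sigma> q" using pl p q eq by (simp add: skew_join_simps)
        then show ?thesis using permutes_inj[OF \<sigma>] by (simp add: inj_eq)
      next
        case top
        then show ?thesis using pl p eq permutes_interval_bounds[OF \<sigma>, of p] by (simp add: skew_join_simps)
      next
        case (right q')
        then show ?thesis using pl p eq permutes_interval_bounds[OF \<sigma>, of p] permutes_interval_bounds[OF \<tau>, of q']
          by (simp add: skew_join_simps)
      qed
    next
      case pt: top
      from q show ?thesis
      proof (cases rule: skew_join_position_cases)
        case left
        then show ?thesis using \<open>0 < q\<close> eq pt permutes_interval_bounds[OF \<sigma>, of q] by (simp add: skew_join_simps)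
      next
        case (right q')
        then show ?thesis using eq pt permutes_interval_bounds[OF \<tau>, of q'] by (simp add: skew_join_simps)
      qed (use pt in simp)
    next
      case pr: (right p')
      from q show ?thesis
      proof (cases rule: skew_join_position_cases)
        case left
        then show ?thesis
          using \<open>0 < q\<close> eq pr permutes_interval_bounds[OF \<sigma>, of q] permutes_interval_bounds[OF \<tau>, of p']
          by (simp add: skew_join_simps)
      next
        case top
        then show ?thesis using eq pr permutes_interval_bounds[OF \<tau>, of p'] by (simp add: skew_join_simps)
      next
        case (right q')
        then have "\<tau> p' = \<tau> q'" using pr eq by (simp add: skew_join_simps)
        then show ?thesis using permutes_inj[OF \<tau>] pr right by (simp add: inj_eq)
      qed
    qed
  qed
  moreover have "?\<pi> ` {1..Suc (l + r)} \<subseteq> {1..Suc (l + r)}"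
  proof (rule image_subsetI)
    fix p assume "p \<in> {1..Suc (l + r)}"
    then have p: "0 < p" "p \<le> Suc (l + r)" by auto
    then show "?\<pi> p \<in> {1..Suc (l + r)}"
    proof (cases rule: skew_join_position_cases)
      case left
      then show ?thesis using p permutes_interval_bounds[OF \<sigma>, of p] by (simp add: skew_join_simps)
    next
      case (right q)
      then show ?thesis using permutes_interval_bounds[OF \<tau>, of q] by (simp add: skew_join_simps)
    qed (simp add: skew_join_simps)
  qed
  ultimately show "bij_betw ?\<pi> {1..Suc (l + r)} {1..Suc (l + r)}"
    by (simp add: bij_betw_def endo_inj_surj)
qed

section \<open>Avoidance of 132 under joining, and existence and uniqueness of the cut\<close>

lemma avoids_132D:
  assumes "avoids_132 n \<pi>" "0 < p" "p < q" "q < r" "r \<le> n" "\<pi> p < \<pi> r"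
  shows "\<pi> q \<le> \<pi> r"
proof (rule ccontr)
  assume "\<not> \<pi> q \<le> \<pi> r"
  then have "contains_132 n \<pi>"
    unfolding contains_132_def using assms(2-)
    by (intro bexI[of _ p] bexI[of _ q] bexI[of _ r]) auto
  then show False using assms(1) by (simp add: avoids_132_def)
qed

lemma avoids_132I:
  assumes "\<And>p q r. 0 < p \<Longrightarrow> p < q \<Longrightarrow> q < r \<Longrightarrow> r \<le> n \<Longrightarrow> \<pi> p < \<pi> r \<Longrightarrow> \<pi> r < \<pi> q \<Longrightarrow> False"
  shows "avoids_132 n \<pi>"
proof -
  have False if "p \<in> {1..n}" "r \<in> {1..n}" "p < q" "q < r" "\<pi> p < \<pi> r" "\<pi> r < \<pi> q" for p q r
    using assms[of p q r] that by simp
  then show ?thesis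
    unfolding avoids_132_def contains_132_def by blast
qed

text \<open>Look at the last entry of a supposed 132. In the left block it pulls the whole pattern
  into \<open>\<sigma>\<close>; it is not the maximum, being smaller than the middle entry; in the
  right block the first entry, being even smaller, and hence the whole pattern lie in
  \<open>\<tau>\<close>.\<close>

lemma skew_join_avoids:
  assumes \<sigma>: "\<sigma> permutes {1..l}" "avoids_132 l \<sigma>" and \<tau>: "\<tau> permutes {1..r}" "avoids_132 r \<tau>"
  shows "avoids_132 (Suc (l + r)) (skew_join l r \<sigma> \<tau>)"
proof (rule avoids_132I)
  note b = permutes_interval_bounds[OF \<sigma>(1)] permutes_interval_bounds[OF \<tau>(1)]
  let ?\<pi> = "skew_join l r \<sigma> \<tau>"
  fix p q t assume a: "0 < p" "p < q" "q < t" "t \<le> Suc (l + r)" "?\<pi> p < ?\<pi> t" "?\<pi> t < ?\<pi> q"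
  have "0 < t" using a by simp
  then show False using a(4)
  proof (cases rule: skew_join_position_cases)
    case left
    then show ?thesis
      using a avoids_132D[OF \<sigma>(2), of p q t] by (auto simp: skew_join_simps)
  next
    case top
    then have "\<sigma> q \<le> l" using a b by auto
    then show ?thesis using a top by (auto simp: skew_join_simps)
  next
    case (right t')
    have "0 < p" "p \<le> Suc (l + r)" using a by auto
    then show ?thesis
    proof (cases rule: skew_join_position_cases)
      case left
      then show ?thesis using a right b(4)[of t'] by (auto simp: skew_join_def)
    next
      case top
      then show ?thesis using a right b(4)[of t'] by (auto simp: skew_join_simps)
    next
      case p: (right p')
      obtain q' where q': "q = Suc l + q'"
        using a p by (metis add_lessD1 le_Suc_ex less_imp_le)
      then have "p' < q'" "q' < t'" using a p right by auto
      then show ?thesis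
        using a p q' right avoids_132D[OF \<tau>(2), of p' q' t'] by (simp add: skew_join_simps)
    qed
  qed
qed

text \<open>The maximum sits at \<open>Suc l\<close>, so injectivity of the joined permutation
  recovers \<open>l\<close>. The blocks are then read off pointwise, and outside their intervals
  they are the identity.\<close>

lemma skew_join_inject:
  assumes \<sigma>: "\<sigma> permutes {1..l}" "\<sigma>' permutes {1..l'}" and \<tau>: "\<tau> permutes {1..r}" "\<tau>' permutes {1..r'}"
    and size: "l + r = l' + r'" and eq: "skew_join l r \<sigma> \<tau> = skew_join l' r' \<sigma>' \<tau>'"
  shows "l = l'" "r = r'" "\<sigma> = \<sigma>'" "\<tau> = \<tau>'"
proof -
  have "skew_join l' r' \<sigma>' \<tau>' (Suc l) = skew_join l' r' \<sigma>' \<tau>' (Suc l')"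
    using eq size by (metis skew_join_simps(2))
  then show l: "l = l'"
    using permutes_inj[OF skew_join_permutes[OF \<sigma>(2) \<tau>(2)]] by (auto dest: injD)
  then show r: "r = r'" using size by simp
  show "\<sigma> = \<sigma>'"
  proof
    fix p show "\<sigma> p = \<sigma>' p"
    proof (cases "p \<in> {1..l}")
      case True
      then show ?thesis using fun_cong[OF eq, of p] l r by (simp add: skew_join_simps)
    next
      case False
      then show ?thesis using \<sigma> l by (metis permutes_not_in)
    qed
  qed
  show "\<tau> = \<tau>'"
  proof
    fix p show "\<tau> p = \<tau>' p"
    proof (cases "p \<in> {1..r}")
      case True
      then show ?thesis using fun_cong[OF eq, of "Suc l + p"] l r by (simp add: skew_join_simps)
    next
      case False
      then show ?thesis using \<tau> r by (metis permutes_not_in)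
    qed
  qed
qed

text \<open>Serves to identify the values to the right of the maximum as the smallest ones.\<close>

lemma downward_closed_eq_interval:
  fixes A :: "nat set"
  assumes "finite A" "0 \<notin> A" and down: "\<And>u v. v \<in> A \<Longrightarrow> 0 < u \<Longrightarrow> u < v \<Longrightarrow> u \<in> A"
  shows "A = {1..card A}"
proof (cases "A = {}")
  case False
  then have "Max A \<in> A" using assms by simp
  have "A = {1..Max A}"
  proof (intro equalityI subsetI)
    fix u assume "u \<in> A"
    then show "u \<in> {1..Max A}"
      using assms Max_ge[of A u] by (cases "u = 0") auto
  next
    fix u assume "u \<in> {1..Max A}"
    then show "u \<in> A"
      using down[OF \<open>Max A \<in> A\<close>, of u] \<open>Max A \<in> A\<close> by (cases "u = Max A") auto
  qed
  then show ?thesis by (metis card_atLeastAtMost diff_Suc_1)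
qed auto

text \<open>Cut at the position \<open>p\<close> of the maximum. An entry before \<open>p\<close>
  smaller than one after \<open>p\<close> would give a 132 with the maximum in the middle, so the
  entries after \<open>p\<close> take exactly the \<open>r\<close> smallest values.\<close>

lemma avoids_132_decompose:
  assumes \<pi>: "\<pi> permutes {1..Suc n}" "avoids_132 (Suc n) \<pi>"
  obtains l r \<sigma> \<tau> where "n = l + r" "\<sigma> permutes {1..l}" "avoids_132 l \<sigma>"
    "\<tau> permutes {1..r}" "avoids_132 r \<tau>" "\<pi> = skew_join l r \<sigma> \<tau>"
proof -
  have inj: "inj \<pi>" using \<pi>(1) by (rule permutes_inj)
  have "Suc n \<in> \<pi> ` {1..Suc n}"
    using permutes_image[OF \<pi>(1)] by auto
  then obtain p where p: "p \<in> {1..Suc n}" "\<pi> p = Suc n"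
    by auto
  define l where "l = p - 1"
  define r where "r = n - l"
  have n: "n = l + r" and pl: "p = Suc l" using p by (auto simp: l_def r_def)
  have \<pi>0: "\<pi> 0 = 0" and \<pi>big: "\<And>x. x > Suc n \<Longrightarrow> \<pi> x = x"
    using permutes_not_in[OF \<pi>(1)] by auto
  note b = permutes_interval_bounds[OF \<pi>(1)]
  have lt_top: "\<pi> a < Suc n" if "0 < a" "a \<le> Suc n" "a \<noteq> p" for a
  proof -
    have "\<pi> a \<noteq> \<pi> p" using inj that by (simp add: inj_eq)
    then show ?thesis using b(2)[of a] that p(2) by simp
  qed
  have gt: "\<pi> c < \<pi> a" if "0 < a" "a < p" "p < c" "c \<le> Suc n" for a c
  proof -
    have "\<pi> a \<noteq> \<pi> c" using inj that by (auto simp: inj_eq)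
    moreover have "\<not> \<pi> a < \<pi> c"
      using avoids_132D[OF \<pi>(2), of a p c] that lt_top[of c] p by auto
    ultimately show ?thesis by simp
  qed
  define A where "A = \<pi> ` {Suc p..Suc n}"
  have "card A = r"
    unfolding A_def by (simp add: card_image inj_on_subset[OF inj] n pl)
  moreover have "A = {1..card A}"
  proof (rule downward_closed_eq_interval)
    show "finite A" by (simp add: A_def)
    show "0 \<notin> A"
    proof
      assume "0 \<in> A"
      then obtain c where "\<pi> c = 0" "p < c" "c \<le> Suc n" by (auto simp: A_def)
      then show False using b(1)[of c] by simp
    qed
    fix u v assume uv: "v \<in> A" "0 < u" "u < v"
    then obtain c where c: "v = \<pi> c" "p < c" "c \<le> Suc n" by (auto simp: A_def)
    have "u \<in> \<pi> ` {1..Suc n}"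
      unfolding permutes_image[OF \<pi>(1)] using uv c b(2)[of c] by auto
    then obtain a where a: "u = \<pi> a" "0 < a" "a \<le> Suc n" by auto
    have "\<not> a < p" using gt[of a c] a c uv by auto
    moreover have "a \<noteq> p" using a p lt_top[of c] c uv by auto
    ultimately show "u \<in> A" using a by (auto simp: A_def)
  qed
  ultimately have A: "A = {1..r}" by simp
  \<comment> \<open>Subtracting \<open>r\<close> never truncates, since the values left of the
    maximum exceed \<open>r\<close>.\<close>
  define \<sigma> where "\<sigma> q = (if 0 < q \<and> q \<le> l then \<pi> q - r else q)" for q
  define \<tau> where "\<tau> q = (if 0 < q \<and> q \<le> r then \<pi> (Suc l + q) else q)" for q
  have left: "r < \<pi> q" "\<pi> q \<le> l + r" if "0 < q" "q \<le> l" for q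
  proof -
    have "\<pi> q \<notin> A"
      using that inj by (auto simp: A_def pl inj_eq)
    then show "r < \<pi> q" using b(1)[of q] that n by (auto simp: A)
    show "\<pi> q \<le> l + r" using lt_top[of q] that pl n by auto
  qed
  have right: "0 < \<pi> (Suc l + q)" "\<pi> (Suc l + q) \<le> r" if "0 < q" "q \<le> r" for q
  proof -
    have "\<pi> (Suc l + q) \<in> A"
      unfolding A_def using that n pl by (intro imageI) auto
    then show "0 < \<pi> (Suc l + q)" "\<pi> (Suc l + q) \<le> r" by (auto simp: A)
  qed
  have \<sigma>: "\<sigma> permutes {1..l}"
  proof (rule bij_imp_permutes)
    have "inj_on \<sigma> {1..l}"
    proof (rule inj_onI)
      fix x y assume xy: "x \<in> {1..l}" "y \<in> {1..l}" "\<sigma> x = \<sigma> y"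
      then have "\<pi> x = \<pi> y" using left[of x] left[of y] by (auto simp: \<sigma>_def)
      then show "x = y" using inj by (simp add: inj_eq)
    qed
    moreover have "\<sigma> ` {1..l} \<subseteq> {1..l}"
      proof (rule image_subsetI)
      fix q assume "q \<in> {1..l}"
      then show "\<sigma> q \<in> {1..l}" using left[of q] by (auto simp: \<sigma>_def)
    qed
    ultimately show "bij_betw \<sigma> {1..l} {1..l}"
      by (simp add: bij_betw_def endo_inj_surj)
  qed (auto simp: \<sigma>_def)
  have \<tau>: "\<tau> permutes {1..r}"
  proof (rule bij_imp_permutes)
    have "inj_on \<tau> {1..r}"
    proof (rule inj_onI)
      fix x y assume xy: "x \<in> {1..r}" "y \<in> {1..r}" "\<tau> x = \<tau> y"
      then have "\<pi> (Suc l + x) = \<pi> (Suc l + y)" by (auto simp: \<tau>_def)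
      then show "x = y" using inj by (simp add: inj_eq)
    qed
    moreover have "\<tau> ` {1..r} \<subseteq> {1..r}"
      proof (rule image_subsetI)
      fix q assume "q \<in> {1..r}"
      then show "\<tau> q \<in> {1..r}" using right[of q] by (auto simp: \<tau>_def)
    qed
    ultimately show "bij_betw \<tau> {1..r} {1..r}"
      by (simp add: bij_betw_def endo_inj_surj)
  qed (auto simp: \<tau>_def)
  show thesis
  proof (rule that[OF n \<sigma> _ \<tau>])
    show "avoids_132 l \<sigma>"
    proof (rule avoids_132I)
      fix x y z assume a: "0 < x" "x < y" "y < z" "z \<le> l" "\<sigma> x < \<sigma> z" "\<sigma> z < \<sigma> y"
      then have "\<pi> x < \<pi> z" "\<pi> z < \<pi> y"
        by (auto simp: \<sigma>_def)
      then show False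
        using avoids_132D[OF \<pi>(2), of x y z] a n by simp
    qed
    show "avoids_132 r \<tau>"
    proof (rule avoids_132I)
      fix x y z assume a: "0 < x" "x < y" "y < z" "z \<le> r" "\<tau> x < \<tau> z" "\<tau> z < \<tau> y"
      then have "\<pi> (Suc l + x) < \<pi> (Suc l + z)" "\<pi> (Suc l + z) < \<pi> (Suc l + y)"
        by (auto simp: \<tau>_def)
      then show False
        using avoids_132D[OF \<pi>(2), of "Suc l + x" "Suc l + y" "Suc l + z"] a n by simp
    qed
    show "\<pi> = skew_join l r \<sigma> \<tau>"
    proof
      fix x
      show "\<pi> x = skew_join l r \<sigma> \<tau> x"
        using left[of x] \<pi>0 \<pi>big[of x] p(2) n pl
        by (auto simp: skew_join_def \<sigma>_def \<tau>_def)
    qed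
  qed
qed

section \<open>Recorded boxes of a join\<close>

lemma record_box_pos:
  assumes "\<pi> permutes {1..n}" "(x, m) \<in> record_boxes n \<pi>"
  shows "0 < x" "0 < m" "m \<le> n"
proof -
  obtain p q where p: "p \<in> {1..n}" "0 < q" "q < p" "\<pi> q < \<pi> p" "(x, m) = record_box \<pi> p"
    using assms by (auto simp: record_boxes_def)
  then show "0 < x"
    using LeastI[of "\<lambda>q. 0 < q \<and> \<pi> q < \<pi> p" q] by (auto simp: record_box_def)
  have "m \<in> \<pi> ` {1..p}"
    using p Min_in[of "\<pi> ` {1..p}"] by (auto simp: record_box_def)
  then show "0 < m" "m \<le> n"
    using permutes_interval_bounds[OF assms(1)] p(1) by auto
qed

lemma finite_record_boxes: "finite (record_boxes n \<pi>)"
  by (simp add: record_boxes_def)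

context
  fixes l r :: nat and \<sigma> \<tau> :: "nat \<Rightarrow> nat"
  assumes \<sigma>: "\<sigma> permutes {1..l}" and \<tau>: "\<tau> permutes {1..r}"
begin

private abbreviation "\<pi> \<equiv> skew_join l r \<sigma> \<tau>"

lemma skew_join_min_left:
  assumes "0 < p" "p \<le> l"
  shows "Min (\<pi> ` {1..p}) = Min (\<sigma> ` {1..p}) + r"
proof -
  have "\<pi> ` {1..p} = (\<lambda>v. v + r) ` \<sigma> ` {1..p}"
    unfolding image_image using assms by (intro image_cong) (auto simp: skew_join_simps)
  then show ?thesis
    using assms by (simp add: mono_Min_commute[of "\<lambda>v. v + r", symmetric] mono_def)
qed

lemma skew_join_record_box_left:
  assumes "p \<le> l" "0 < q" "q < p" "\<sigma> q < \<sigma> p"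
  shows "record_box \<pi> p = apsnd (\<lambda>m. m + r) (record_box \<sigma> p)"
proof -
  let ?m = "LEAST q. 0 < q \<and> \<sigma> q < \<sigma> p"
  have m: "0 < ?m \<and> \<sigma> ?m < \<sigma> p"
    using assms by (intro LeastI[of "\<lambda>q. 0 < q \<and> \<sigma> q < \<sigma> p" q]) simp
  have "?m \<le> q" using assms by (intro Least_le) simp
  have "(LEAST q. 0 < q \<and> \<pi> q < \<pi> p) = ?m"
  proof (rule Least_equality)
    show "0 < ?m \<and> \<pi> ?m < \<pi> p"
      using m \<open>?m \<le> q\<close> assms by (simp add: skew_join_simps)
    fix x assume x: "0 < x \<and> \<pi> x < \<pi> p"
    show "?m \<le> x"
    proof (rule ccontr)
      assume "\<not> ?m \<le> x"
      then have "x < ?m" by simp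
      then show False
        using not_less_Least[OF \<open>x < ?m\<close>] x \<open>?m \<le> q\<close> assms by (auto simp: skew_join_simps)
    qed
  qed
  then show ?thesis
    using skew_join_min_left[of p] assms by (simp add: record_box_def)
qed

text \<open>Already the first entry lies below the maximum, and the entry 1 of
  \<open>\<sigma>\<close>, the smallest of the prefix, has been raised to
  \<open>Suc r\<close>.\<close>

lemma skew_join_record_box_top:
  assumes "0 < l"
  shows "record_box \<pi> (Suc l) = (1, Suc r)"
proof -
  have "(LEAST q. 0 < q \<and> \<pi> q < \<pi> (Suc l)) = 1"
    using assms permutes_interval_bounds[OF \<sigma>, of 1]
    by (intro Least_equality) (auto simp: skew_join_simps)
  moreover have "Min (\<pi> ` {1..Suc l}) = Suc r"
  proof (rule Min_eqI)
    have "1 \<in> \<sigma> ` {1..l}"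
      unfolding permutes_image[OF \<sigma>] using assms by simp
    then obtain p where p: "\<sigma> p = 1" "0 < p" "p \<le> l" by auto
    then have "\<pi> p = Suc r" by (simp add: skew_join_simps)
    then show "Suc r \<in> \<pi> ` {1..Suc l}"
      using p by (metis atLeastAtMost_iff image_eqI le_Suc_eq less_eq_Suc_le One_nat_def)
  qed (use permutes_interval_bounds(1)[OF \<sigma>] assms in \<open>auto simp: skew_join_def Suc_le_eq\<close>)
  ultimately show ?thesis by (simp add: record_box_def)
qed

lemma skew_join_above_right:
  assumes "0 < p" "p \<le> Suc l" "0 < q" "q \<le> r"
  shows "\<tau> q < \<pi> p"
  using permutes_interval_bounds[OF \<sigma>, of p] permutes_interval_bounds[OF \<tau>, of q] assms
  by (auto simp: skew_join_def)

text \<open>All entries up to and including the maximum exceed every entry of \<open>\<tau>\<close>,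
  so they affect neither the first smaller position nor the prefix minimum.\<close>

lemma skew_join_record_box_right:
  assumes "p \<le> r" "0 < q" "q < p" "\<tau> q < \<tau> p"
  shows "record_box \<pi> (Suc l + p) = apfst (\<lambda>x. Suc l + x) (record_box \<tau> p)"
proof -
  let ?m = "LEAST q. 0 < q \<and> \<tau> q < \<tau> p"
  have m: "0 < ?m \<and> \<tau> ?m < \<tau> p"
    using assms by (intro LeastI[of "\<lambda>q. 0 < q \<and> \<tau> q < \<tau> p" q]) simp
  have "?m \<le> q" using assms by (intro Least_le) simp
  have \<pi>p: "\<pi> (Suc l + p) = \<tau> p"
    using assms by (intro skew_join_simps) auto
  have "(LEAST q. 0 < q \<and> \<pi> q < \<pi> (Suc l + p)) = Suc l + ?m"
  proof (rule Least_equality)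
    have "\<pi> (Suc l + ?m) = \<tau> ?m"
      using m \<open>?m \<le> q\<close> assms by (intro skew_join_simps) auto
    then show "0 < Suc l + ?m \<and> \<pi> (Suc l + ?m) < \<pi> (Suc l + p)"
      using m \<pi>p by simp
    fix x assume x: "0 < x \<and> \<pi> x < \<pi> (Suc l + p)"
    show "Suc l + ?m \<le> x"
    proof (rule ccontr)
      assume "\<not> Suc l + ?m \<le> x"
      then have less: "x < Suc l + ?m" by simp
      have "Suc l < x"
        using skew_join_above_right[of x p] x \<pi>p assms by (cases "x \<le> Suc l") auto
      then obtain y where y: "0 < y" "x = Suc l + y"
        by (metis add_diff_inverse_nat less_imp_le not_le zero_less_diff)
      then have "y < ?m" using less by simp
      moreover have "\<pi> x = \<tau> y"
        unfolding y(2) using y(1) \<open>y < ?m\<close> \<open>?m \<le> q\<close> assms by (intro skew_join_simps) auto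
      ultimately show False
        using not_less_Least[of y "\<lambda>q. 0 < q \<and> \<tau> q < \<tau> p"] x y \<pi>p by auto
    qed
  qed
  moreover have "Min (\<pi> ` {1..Suc l + p}) = Min (\<tau> ` {1..p})"
  proof (rule Min_eqI)
    have "Min (\<tau> ` {1..p}) \<in> \<tau> ` {1..p}"
      using assms by (intro Min_in) auto
    then obtain x where x: "x \<in> {1..p}" "Min (\<tau> ` {1..p}) = \<tau> x"
      by auto
    moreover have "\<pi> (Suc l + x) = \<tau> x"
      using x assms by (intro skew_join_simps) auto
    ultimately show "Min (\<tau> ` {1..p}) \<in> \<pi> ` {1..Suc l + p}"
      by (intro image_eqI[of _ _ "Suc l + x"]) auto
    fix v assume "v \<in> \<pi> ` {1..Suc l + p}"
    then obtain y where y: "0 < y" "y \<le> Suc l + p" "v = \<pi> y"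
      by (auto simp: Suc_le_eq)
    have "y \<le> Suc (l + r)" using y assms by simp
    have le: "Min (\<tau> ` {1..p}) \<le> \<tau> p"
      using assms by (intro Min_le) auto
    from \<open>0 < y\<close> \<open>y \<le> Suc (l + r)\<close> show "Min (\<tau> ` {1..p}) \<le> v"
    proof (cases rule: skew_join_position_cases)
      case (right z)
      then have "v = \<tau> z" using y by (metis skew_join_simps(3))
      then show ?thesis using right y assms by (auto intro!: Min_le)
    next
      case left
      then have "\<tau> p < v" using skew_join_above_right[of y p] y assms by auto
      then show ?thesis using le by linarith
    next
      case top
      then have "\<tau> p < v" using skew_join_above_right[of y p] y assms by auto
      then show ?thesis using le by linarith
    qed
  qed auto
  ultimately show ?thesis by (simp add: record_box_def)
qed

text \<open>The left block keeps its positions and the right block its values, so each contributes a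
  translate of its own boxes: in the value coordinate by \<open>r\<close>, in the position
  coordinate by \<open>Suc l\<close>. With \<open>l = 0\<close> the maximum comes first and is
  itself a left-to-right minimum.\<close>

lemma skew_join_record_boxes:
  "record_boxes (Suc (l + r)) \<pi> =
     apsnd (\<lambda>m. m + r) ` record_boxes l \<sigma> \<union> (if l = 0 then {} else {(1, Suc r)})
       \<union> apfst (\<lambda>x. Suc l + x) ` record_boxes r \<tau>"
    (is "_ = ?A \<union> ?B \<union> ?C")
proof (intro equalityI subsetI)
  fix b assume "b \<in> record_boxes (Suc (l + r)) \<pi>"
  then obtain p q where p: "0 < p" "p \<le> Suc (l + r)" "0 < q" "q < p" "\<pi> q < \<pi> p" "b = record_box \<pi> p"
    by (auto simp: record_boxes_def)
  from p(1,2) show "b \<in> ?A \<union> ?B \<union> ?C"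
  proof (cases rule: skew_join_position_cases)
    case left
    then have "\<sigma> q < \<sigma> p" using p by (simp add: skew_join_simps)
    then have "record_box \<sigma> p \<in> record_boxes l \<sigma>" "b = apsnd (\<lambda>m. m + r) (record_box \<sigma> p)"
      using p left skew_join_record_box_left[of p q] by (auto simp: record_boxes_def)
    then show ?thesis by blast
  next
    case top
    then show ?thesis using p skew_join_record_box_top by auto
  next
    case (right p')
    have \<pi>p: "\<pi> p = \<tau> p'" using right by (metis skew_join_simps(3))
    then have "Suc l < q"
      using skew_join_above_right[of q p'] p right by (cases "q \<le> Suc l") auto
    then obtain q' where q': "0 < q'" "q = Suc l + q'"
      by (metis add_diff_inverse_nat less_imp_le not_le zero_less_diff)
    have "\<pi> q = \<tau> q'"
      unfolding q'(2) using q' p right by (intro skew_join_simps) auto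
    then have "\<tau> q' < \<tau> p'" "q' < p'" using p right \<pi>p q' by auto
    then have "record_box \<tau> p' \<in> record_boxes r \<tau>" "b = apfst (\<lambda>x. Suc l + x) (record_box \<tau> p')"
      using p right q' skew_join_record_box_right[of p' q'] by (auto simp: record_boxes_def)
    then show ?thesis by blast
  qed
next
  fix b assume "b \<in> ?A \<union> ?B \<union> ?C"
  then consider (A) "b \<in> ?A" | (B) "0 < l" "b = (1, Suc r)" | (C) "b \<in> ?C"
    by (auto split: if_splits)
  then show "b \<in> record_boxes (Suc (l + r)) \<pi>"
  proof cases
    case A
    then obtain p q where p: "0 < p" "p \<le> l" "0 < q" "q < p" "\<sigma> q < \<sigma> p"
      "b = apsnd (\<lambda>m. m + r) (record_box \<sigma> p)"
      by (auto simp: record_boxes_def)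
    then have "b = record_box \<pi> p" "\<pi> q < \<pi> p"
      using skew_join_record_box_left[of p q] by (auto simp: skew_join_simps)
    then show ?thesis using p by (auto simp: record_boxes_def)
  next
    case B
    then have "b = record_box \<pi> (Suc l)" "\<pi> 1 < \<pi> (Suc l)"
      using skew_join_record_box_top permutes_interval_bounds[OF \<sigma>, of 1]
      by (auto simp: skew_join_simps)
    then show ?thesis using B by (auto simp: record_boxes_def intro!: imageI exI[of _ 1])
  next
    case C
    then obtain p q where p: "0 < p" "p \<le> r" "0 < q" "q < p" "\<tau> q < \<tau> p"
      "b = apfst (\<lambda>x. Suc l + x) (record_box \<tau> p)"
      by (auto simp: record_boxes_def)
    then have "b = record_box \<pi> (Suc l + p)"
      using skew_join_record_box_right[of p q] by auto
    moreover have "\<pi> (Suc l + p) = \<tau> p" "\<pi> (Suc l + q) = \<tau> q"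
      using p by (auto intro!: skew_join_simps)
    ultimately show ?thesis
      using p unfolding record_boxes_def by (intro image_eqI[of _ _ "Suc l + p"]) (auto intro!: exI[of _ "Suc l + q"])
  qed
qed

text \<open>Column values above \<open>r\<close> separate left boxes from right ones. The box
  \<open>(1, Suc r)\<close> of the maximum is the translate of \<open>(1, 1)\<close>, so it is new
  exactly when \<open>\<sigma>\<close> does not occupy that corner.\<close>

lemma card_skew_join_record_boxes:
  "card (record_boxes (Suc (l + r)) \<pi>) =
     card (record_boxes l \<sigma>) + (if l = 0 \<or> (1, 1) \<in> record_boxes l \<sigma> then 0 else 1)
       + card (record_boxes r \<tau>)"
    (is "_ = ?c")
proof -
  let ?A = "apsnd (\<lambda>m. m + r) ` record_boxes l \<sigma>"
  let ?B = "if l = 0 then {} else {(1, Suc r)}"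
  let ?C = "apfst (\<lambda>x. Suc l + x) ` record_boxes r \<tau>"
  have "r < snd b" if "b \<in> ?A" for b
    using that by (auto dest: record_box_pos(2)[OF \<sigma>])
  then have "r < snd b" if "b \<in> ?A \<union> ?B" for b
    using that by (elim UnE) (auto split: if_splits)
  moreover have "snd b \<le> r" if "b \<in> ?C" for b
    using that by (auto dest: record_box_pos(3)[OF \<tau>])
  ultimately have "(?A \<union> ?B) \<inter> ?C = {}"
    by (metis disjoint_iff not_le)
  then have "card (?A \<union> ?B \<union> ?C) = card (?A \<union> ?B) + card ?C"
    by (intro card_Un_disjoint) (simp_all add: finite_record_boxes)
  also have "card ?C = card (record_boxes r \<tau>)"
    by (intro card_image inj_onI) auto
  also have "card ?A = card (record_boxes l \<sigma>)"
    by (intro card_image inj_onI) auto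
  then have "card (?A \<union> ?B) = card (record_boxes l \<sigma>) + (if l = 0 \<or> (1, 1) \<in> record_boxes l \<sigma> then 0 else 1)"
    using finite_record_boxes[of l \<sigma>] by (auto simp: card_insert_if image_iff)
  finally show ?thesis
    unfolding skew_join_record_boxes .
qed

text \<open>\<open>(1, 1)\<close> is the box in the top row and last column. Boxes of the left block
  and of the maximum have value coordinate above \<open>r\<close>, those of the right block have
  position coordinate above 1; hence only \<open>r = 0\<close> allows the corner, and then the
  maximum fills it.\<close>

lemma skew_join_corner_iff: "(1, 1) \<in> record_boxes (Suc (l + r)) \<pi> \<longleftrightarrow> 0 < l \<and> r = 0"
proof -
  define A where "A = apsnd (\<lambda>m. m + r) ` record_boxes l \<sigma>"
  define C where "C = apfst (\<lambda>x. Suc l + x) ` record_boxes r \<tau>"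
  have "(1, 1) \<in> A \<longrightarrow> 0 < l \<and> r = 0"
    unfolding A_def by (cases "l = 0") (auto simp: record_boxes_def[of 0] dest: record_box_pos(2)[OF \<sigma>])
  moreover have "(1, 1) \<notin> C"
    unfolding C_def by (auto dest: record_box_pos(1)[OF \<tau>])
  ultimately show ?thesis
    unfolding skew_join_record_boxes A_def[symmetric] C_def[symmetric] by auto
qed

end

section \<open>Permutations from binary trees\<close>

text \<open>\<open>size\<close> counts the \<open>Bin\<close> nodes, hence the entries of the
  associated permutation.\<close>

datatype shape = Tip | Bin shape shape

primrec perm_of :: "shape \<Rightarrow> nat \<Rightarrow> nat" where
  "perm_of Tip = id"
| "perm_of (Bin L R) = skew_join (size L) (size R) (perm_of L) (perm_of R)"

text \<open>The trees whose permutation has at least two entries and ends in its maximum.\<close>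

primrec capped :: "shape \<Rightarrow> bool" where
  "capped Tip \<longleftrightarrow> False"
| "capped (Bin L R) \<longleftrightarrow> L \<noteq> Tip \<and> R = Tip"

primrec boxes :: "shape \<Rightarrow> nat" where
  "boxes Tip = 0"
| "boxes (Bin L R) = boxes L + (if L = Tip \<or> capped L then 0 else 1) + boxes R"

lemma size_shape_0_iff: "size (t :: shape) = 0 \<longleftrightarrow> t = Tip"
  by (cases t) auto

lemma perm_of_permutes: "perm_of t permutes {1..size t}"
  by (induction t) (use skew_join_permutes in \<open>auto simp: permutes_id\<close>)

lemma perm_of_avoids: "avoids_132 (size t) (perm_of t)"
proof (induction t)
  case (Bin L R)
  then show ?case using skew_join_avoids perm_of_permutes by simp
qed (simp add: avoids_132_def contains_132_def)

lemma perm_of_corner_iff: "(1, 1) \<in> record_boxes (size t) (perm_of t) \<longleftrightarrow> capped t"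
proof (cases t)
  case (Bin L R)
  then show ?thesis
    using skew_join_corner_iff[OF perm_of_permutes[of L] perm_of_permutes[of R]] size_shape_0_iff[of L] size_shape_0_iff[of R]
    by auto
qed (simp add: record_boxes_def)

lemma card_record_boxes_perm_of: "card (record_boxes (size t) (perm_of t)) = boxes t"
proof (induction t)
  case (Bin L R)
  then show ?case
    using card_skew_join_record_boxes[OF perm_of_permutes[of L] perm_of_permutes[of R]]
      perm_of_corner_iff[of L] size_shape_0_iff[of L]
    by simp
qed (simp add: record_boxes_def)

lemma perm_of_inject: "size t = size u \<Longrightarrow> perm_of t = perm_of u \<Longrightarrow> t = u"
proof (induction t arbitrary: u)
  case Tip
  then show ?case using size_shape_0_iff[of u] by simp
next
  case (Bin L R)
  then obtain L' R' where u: "u = Bin L' R'"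
    by (cases u) auto
  then have "size L + size R = size L' + size R'"
    "skew_join (size L) (size R) (perm_of L) (perm_of R) = skew_join (size L') (size R') (perm_of L') (perm_of R')"
    using Bin.prems by auto
  note eqs = skew_join_inject[OF perm_of_permutes perm_of_permutes perm_of_permutes perm_of_permutes this]
  then show ?case
    using Bin.IH u by auto
qed

lemma perm_of_surj:
  "\<pi> permutes {1..n} \<Longrightarrow> avoids_132 n \<pi> \<Longrightarrow> \<exists>t. size t = n \<and> perm_of t = \<pi>"
proof (induction n arbitrary: \<pi> rule: less_induct)
  case (less n)
  show ?case
  proof (cases n)
    case 0
    then show ?thesis using less.prems by (intro exI[of _ Tip]) auto
  next
    case (Suc k)
    obtain l r \<sigma> \<tau> where d: "k = l + r" "\<sigma> permutes {1..l}" "avoids_132 l \<sigma>"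
      "\<tau> permutes {1..r}" "avoids_132 r \<tau>" "\<pi> = skew_join l r \<sigma> \<tau>"
      using less.prems unfolding Suc by (rule avoids_132_decompose)
    obtain L R where "size L = l" "perm_of L = \<sigma>" "size R = r" "perm_of R = \<tau>"
      using less.IH[of l \<sigma>] less.IH[of r \<tau>] d Suc by auto
    then show ?thesis using d Suc by (intro exI[of _ "Bin L R"]) auto
  qed
qed

lemma J_eq_card_shapes: "J n k = card {t. size t = n \<and> boxes t = k}"
proof -
  have "{\<pi>. \<pi> permutes {1..n} \<and> avoids_132 n \<pi> \<and> card (nonzero_boxes n \<pi>) = k}
      = perm_of ` {t. size t = n \<and> boxes t = k}"
    using perm_of_surj card_record_boxes_perm_of perm_of_permutes perm_of_avoids
    by (fastforce simp: card_nonzero_boxes)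
  moreover have "inj_on perm_of {t. size t = n \<and> boxes t = k}"
    using perm_of_inject by (auto intro!: inj_onI)
  ultimately show ?thesis
    by (simp add: J_def card_image)
qed

section \<open>Power series for the central binomial coefficients\<close>

unbundle fps_syntax

text \<open>Two absorption identities, linked by the symmetry of row \<open>2 * m + 1\<close> of
  Pascal's triangle.\<close>

lemma central_binomial_Suc:
  "real (Suc m) * real ((2 * Suc m) choose Suc m) = 2 * real (Suc (2 * m)) * real ((2 * m) choose m)"
proof -
  have "((2 * Suc m) choose Suc m) * Suc m = Suc (Suc (2 * m)) * (Suc (2 * m) choose m)"
    unfolding Suc_times_binomial_eq by simp
  also have "Suc (2 * m) choose m = Suc (2 * m) choose Suc m"
    using binomial_symmetric[of m "Suc (2 * m)"] by (simp del: binomial_Suc_Suc)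
  also have "Suc (Suc (2 * m)) * (Suc (2 * m) choose Suc m) = 2 * ((Suc (2 * m) choose Suc m) * Suc m)"
    by (simp del: binomial_Suc_Suc)
  also have "(Suc (2 * m) choose Suc m) * Suc m = Suc (2 * m) * ((2 * m) choose m)"
    by (rule Suc_times_binomial_eq[symmetric])
  finally have "real (((2 * Suc m) choose Suc m) * Suc m) = real (2 * (Suc (2 * m) * ((2 * m) choose m)))"
    by (rule arg_cong)
  then show ?thesis
    unfolding of_nat_mult by (simp only: mult_ac of_nat_numeral)
qed

text \<open>\<open>R\<close> is the inverse square root of \<open>1 - 4 * fps_X ^ 3\<close>.
  Differentiating \<open>s\<^sup>2\<close> and \<open>R * s = 1\<close> gives its derivative; the
  resulting linear differential equation yields a recurrence with step 3, which the central binomial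
  coefficients satisfy too.\<close>

lemma central_binomial_fps:
  fixes s R :: "real fps"
  assumes s: "s\<^sup>2 = 1 - 4 * fps_X ^ 3" and R: "R * s = 1" and R0: "R $ 0 = 1"
  shows "fps_deriv R = 6 * fps_X\<^sup>2 * R ^ 3"
    and "R $ (3 * m) = real ((2 * m) choose m)"
proof -
  have RR: "R\<^sup>2 * (1 - 4 * fps_X ^ 3) = 1"
    using R unfolding s[symmetric] by (simp flip: power_mult_distrib)
  have "fps_deriv (s\<^sup>2) = fps_deriv (1 - 4 * fps_X ^ 3)"
    using s by simp
  then have "2 * s * fps_deriv s = - 12 * fps_X\<^sup>2"
    by (simp add: fps_deriv_power power2_eq_square algebra_simps numeral_3_eq_3)
  then have "2 * (s * fps_deriv s) = 2 * (- 6 * fps_X\<^sup>2)"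
    by (simp add: mult.assoc)
  then have ds: "s * fps_deriv s = - 6 * fps_X\<^sup>2"
    by (subst (asm) mult_left_cancel) auto
  have "fps_deriv (R * s) = 0"
    using R by simp
  then have "fps_deriv R * s = - (R * fps_deriv s)"
    by (simp add: algebra_simps eq_neg_iff_add_eq_0)
  moreover have "fps_deriv R = (fps_deriv R * s) * R"
    using R by (simp add: mult.assoc mult.commute[of s])
  ultimately have "fps_deriv R = - (R * fps_deriv s) * R"
    by simp
  also have "\<dots> = - (R\<^sup>2 * (R * s) * fps_deriv s)"
    using R by (simp add: power2_eq_square algebra_simps)
  also have "\<dots> = - (R ^ 3 * (s * fps_deriv s))"
    by (simp add: power2_eq_square power3_eq_cube algebra_simps)
  finally show dR: "fps_deriv R = 6 * fps_X\<^sup>2 * R ^ 3"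
    unfolding ds by (simp add: algebra_simps)
  \<comment> \<open>One factor \<open>R\<^sup>2\<close> is absorbed by \<open>RR\<close>, which
    makes the cubic differential equation linear.\<close>
  have "fps_deriv R * (1 - 4 * fps_X ^ 3) = 6 * fps_X\<^sup>2 * R * (R\<^sup>2 * (1 - 4 * fps_X ^ 3))"
    unfolding dR by (simp add: power2_eq_square power3_eq_cube algebra_simps)
  then have eq: "fps_deriv R = 4 * (fps_X ^ 3 * fps_deriv R) + 6 * (fps_X\<^sup>2 * R)"
    unfolding RR by (simp add: algebra_simps)
  have rec: "real (n + 3) * R $ (n + 3) = (4 * real n + 6) * R $ n" for n
  proof -
    have "fps_deriv R $ (n + 2) = (4 * (fps_X ^ 3 * fps_deriv R) + 6 * (fps_X\<^sup>2 * R)) $ (n + 2)"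
      using eq by simp
    then show ?thesis
      \<comment> \<open>The case \<open>n = 0\<close> is separate: there
        \<open>fps_X ^ 3 * fps_deriv R\<close> contributes nothing at index 2.\<close>
      by (cases n; simp add: fps_X_power_mult_nth numeral_fps_const distrib_right; simp add: numeral_eq_Suc algebra_simps)
  qed
  show "R $ (3 * m) = real ((2 * m) choose m)"
  proof (induction m)
    case (Suc m)
    note 1 = central_binomial_Suc[of m]
    have 2: "3 * (real (Suc m) * R $ (3 * Suc m)) = 3 * (2 * real (Suc (2 * m)) * R $ (3 * m))"
      using rec[of "3 * m"] by (simp add: algebra_simps)
    have "real (Suc m) * R $ (3 * Suc m) = real (Suc m) * real ((2 * Suc m) choose Suc m)"
      using 1 2 Suc.IH by simp
    then show ?case
      by (metis mult_cancel_left of_nat_eq_0_iff nat.distinct(2))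
  qed (use R0 in simp)
qed

section \<open>Solving for the part of excess 3\<close>

lemma excess_three_coefficient:
  fixes D1 D2 D3 :: "real fps"
  assumes D1: "D1 = fps_X\<^sup>2 + fps_X * D1\<^sup>2"
    and D2: "D2 = fps_X + fps_X\<^sup>2 * D1 + 2 * fps_X * D1 * D2"
    and D3: "D3 = 2 * fps_X * D1 + fps_X\<^sup>2 * D2 + fps_X * (2 * D1 * D3 + D2\<^sup>2)"
    and "m \<ge> 1"
  shows "8 * D3 $ (3 * m) = (8 + 9 * real m) * real ((2 * m) choose m) - 2 * real ((2 * (m - 1)) choose (m - 1))"
proof -
  \<comment> \<open>Completing the square in \<open>D1\<close> gives \<open>s\<close>; it is also
    the coefficient of \<open>D2\<close> and of \<open>D3\<close> once their linear equations are
    collected.\<close>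
  define s where "s = 1 - 2 * fps_X * D1"
  define R where "R = inverse s"
  have s0: "s $ 0 = 1"
    by (simp add: s_def fps_mult_nth mult.assoc)
  have "s\<^sup>2 = 1 - 4 * fps_X * (D1 - fps_X * D1\<^sup>2)"
    by (simp add: s_def power2_eq_square algebra_simps)
  also have "D1 - fps_X * D1\<^sup>2 = fps_X\<^sup>2"
    using D1 by (simp add: algebra_simps)
  finally have s2: "s\<^sup>2 = 1 - 4 * fps_X ^ 3"
    by (simp add: power2_eq_square power3_eq_cube algebra_simps)
  have Rs: "R * s = 1"
    unfolding R_def using s0 by (intro inverse_mult_eq_1) simp
  have R0: "R $ 0 = 1"
    using s0 by (simp add: R_def)
  note R = central_binomial_fps[OF s2 Rs R0]
  have x1: "2 * fps_X * D1 = 1 - s" by (simp add: s_def)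
  have "D2 * s = fps_X + fps_X\<^sup>2 * D1"
    using D2 by (simp add: s_def power2_eq_square algebra_simps)
  then have "2 * (D2 * s) = fps_X * (2 + 2 * fps_X * D1)"
    by (simp add: power2_eq_square algebra_simps)
  then have e2: "2 * (D2 * s) = fps_X * (3 - s)"
    unfolding x1 by simp
  have e3: "D3 * s = (1 - s) + fps_X\<^sup>2 * D2 + fps_X * D2\<^sup>2"
    using D3 by (simp add: s_def power2_eq_square algebra_simps)
  \<comment> \<open>The factor \<open>4 * s\<^sup>2\<close> clears denominators, so that
    \<open>D2\<close> occurs only as \<open>2 * (D2 * s)\<close>, known from
    \<open>e2\<close>.\<close>
  have "4 * (D3 * s ^ 3) = 4 * s\<^sup>2 * (D3 * s)"
    by (simp add: power2_eq_square power3_eq_cube algebra_simps)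
  also have "\<dots> = 4 * s\<^sup>2 * (1 - s) + 2 * fps_X\<^sup>2 * s * (2 * (D2 * s)) + fps_X * (2 * (D2 * s))\<^sup>2"
    unfolding e3 by (simp add: power2_eq_square algebra_simps)
  also have "\<dots> = 4 * s\<^sup>2 * (1 - s) + fps_X ^ 3 * (9 - s\<^sup>2)"
    unfolding e2 by (simp add: power2_eq_square power3_eq_cube algebra_simps)
  finally have e4: "4 * (D3 * s ^ 3) = 4 * s\<^sup>2 * (1 - s) + fps_X ^ 3 * (9 - s\<^sup>2)" .
  have "4 * D3 = 4 * (D3 * s ^ 3) * R ^ 3"
    using Rs by (simp add: mult.assoc mult.commute flip: power_mult_distrib)
  also have "\<dots> = 4 * (R * s)\<^sup>2 * (R - R * s) + fps_X ^ 3 * (9 * R ^ 3 - (R * s)\<^sup>2 * R)"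
    unfolding e4 by (simp add: power2_eq_square power3_eq_cube algebra_simps)
  finally have "4 * D3 = 4 * (R - 1) + fps_X ^ 3 * (9 * R ^ 3 - R)"
    unfolding Rs by simp
  then have "2 * (4 * D3) = 2 * (4 * (R - 1) + fps_X ^ 3 * (9 * R ^ 3 - R))"
    by simp
  \<comment> \<open>Doubling turns \<open>9 * R ^ 3\<close> into 18, that is 3 times the 6 in the
    formula for \<open>fps_deriv R\<close>; the cube of \<open>R\<close> thus becomes a
    derivative.\<close>
  then have "8 * D3 = 8 * (R - 1) + 3 * (fps_X * (6 * fps_X\<^sup>2 * R ^ 3)) - 2 * (fps_X ^ 3 * R)"
    by (simp add: power2_eq_square power3_eq_cube algebra_simps)
  then have "8 * D3 = 8 * (R - 1) + 3 * (fps_X * fps_deriv R) - 2 * (fps_X ^ 3 * R)"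
    unfolding R(1) .
  then have "(8 * D3) $ (3 * m) = (8 * (R - 1) + 3 * (fps_X * fps_deriv R) - 2 * (fps_X ^ 3 * R)) $ (3 * m)"
    by simp
  \<comment> \<open>\<open>fps_X * fps_deriv R\<close> multiplies the coefficient by its index
    \<open>3 * m\<close>. Since \<open>m \<ge> 1\<close>, the constant term drops out and the shift
    by 3 lands at \<open>m - 1\<close>.\<close>
  then have "8 * D3 $ (3 * m) = 8 * R $ (3 * m) + 3 * (3 * real m * R $ (3 * m)) - 2 * R $ (3 * (m - 1))"
    using \<open>m \<ge> 1\<close>
    by (cases m; simp add: fps_X_power_mult_nth numeral_fps_const distrib_right distrib_left right_diff_distrib;
      simp add: numeral_3_eq_3)
  then show ?thesis
    unfolding R(2) by (simp add: algebra_simps)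
qed

text \<open>With \<open>i = k + 2\<close> the denominators are \<open>k + 1\<close> and
  \<open>k + 2\<close>, and all three binomial coefficients are rational multiples of
  \<open>c\<close>.\<close>

lemma central_binomial_combination:
  assumes "i \<ge> 2"
  shows "(8 + 9 * real i) * real ((2 * i) choose i) - 2 * real ((2 * (i - 1)) choose (i - 1))
     = 8 * (real ((2 * i - 2) choose i) * ((9 * real i ^ 2 + 3 * real i - 4) / (2 * (real i - 1))))"
proof -
  obtain k where k: "i = Suc (Suc k)"
    using assms by (metis add_2_eq_Suc le_Suc_ex)
  define c where "c = real ((2 * k + 2) choose (k + 1))"
  have "real k + 1 \<noteq> 0" "real k + 2 \<noteq> 0"
    by linarith+
  have 1: "(real k + 2) * real ((2 * i) choose i) = 2 * (2 * real k + 3) * c"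
    using central_binomial_Suc[of "k + 1"] by (simp add: k c_def algebra_simps)
  have "(2 * k + 2) choose (k + 2) = (2 * k + 2) choose k"
    using binomial_symmetric[of k "2 * k + 2"] by simp
  moreover have "(2 * k + 2 - k) * ((2 * k + 2) choose k) = (k + 1) * ((2 * k + 2) choose (k + 1))"
    using binomial_absorb_comp[of "2 * k + 2" k] Suc_times_binomial_eq[of "2 * k + 1" k] binomial_absorption[of k "2 * k + 1"]
    by simp
  ultimately have "(k + 2) * ((2 * k + 2) choose (k + 2)) = (k + 1) * ((2 * k + 2) choose (k + 1))"
    by simp
  then have "real ((k + 2) * ((2 * k + 2) choose (k + 2))) = real ((k + 1) * ((2 * k + 2) choose (k + 1)))"
    by (rule arg_cong)
  then have 2: "(real k + 2) * real ((2 * i - 2) choose i) = (real k + 1) * c"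
    by (simp add: k c_def algebra_simps)
  have A: "real ((2 * i) choose i) = 2 * (2 * real k + 3) * c / (real k + 2)"
    using 1 \<open>real k + 2 \<noteq> 0\<close> by (simp add: field_simps)
  have B: "real ((2 * i - 2) choose i) = (real k + 1) * c / (real k + 2)"
    using 2 \<open>real k + 2 \<noteq> 0\<close> by (simp add: field_simps)
  have C: "real ((2 * (i - 1)) choose (i - 1)) = c"
    by (simp add: k c_def)
  show ?thesis
    unfolding A B C using \<open>real k + 1 \<noteq> 0\<close> \<open>real k + 2 \<noteq> 0\<close>
    by (simp add: k divide_simps power2_eq_square) (simp add: algebra_simps)
qed

section \<open>Counting trees by excess and size\<close>

text \<open>The subtraction never truncates, by the bound that follows.\<close>

definition excess :: "shape \<Rightarrow> nat" where
  "excess t = 2 * size t - 3 * boxes t"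

text \<open>The extra unit for uncapped trees carries the induction: a new box costs 3, the root
  pays 2, and the third unit is the spare one of the uncapped left subtree.\<close>

lemma boxes_bound: "t \<noteq> Tip \<Longrightarrow> 3 * boxes t + (if capped t then 1 else 2) \<le> 2 * size t"
proof (induction t)
  case (Bin L R)
  then show ?case
    by (cases "L = Tip"; cases "R = Tip") (auto split: if_splits)
qed simp

lemma excess_Tip_Bin: "excess (Bin Tip R) = 2 + excess R"
  using boxes_bound[of R] by (cases "R = Tip") (auto simp: excess_def split: if_splits)

text \<open>The root adds 2; above an uncapped subtree it also creates a box, a net loss of
  1.\<close>

lemma excess_Bin_Tip:
  assumes "L \<noteq> Tip"
  shows "if capped L then excess (Bin L Tip) = 2 + excess L else Suc (excess (Bin L Tip)) = excess L"
  using boxes_bound[OF assms] assms by (auto simp: excess_def split: if_splits)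

text \<open>Whether the root creates a box depends on \<open>L\<close> alone, so root and box are
  charged to \<open>Bin L Tip\<close>.\<close>

lemma excess_Bin:
  assumes "L \<noteq> Tip" "R \<noteq> Tip"
  shows "excess (Bin L R) = excess (Bin L Tip) + excess R"
  using boxes_bound[of L] boxes_bound[of R] assms by (auto simp: excess_def split: if_splits)

lemma finite_shapes_le: "finite {t :: shape. size t \<le> n}"
proof (induction n)
  case 0
  have "{t :: shape. size t \<le> 0} \<subseteq> {Tip}"
  proof
    fix t :: shape assume "t \<in> {t. size t \<le> 0}"
    then show "t \<in> {Tip}" by (cases t) auto
  qed
  then show ?case by (rule finite_subset) simp
next
  case (Suc n)
  have "{t :: shape. size t \<le> Suc n} \<subseteq> insert Tip (case_prod Bin ` ({t. size t \<le> n} \<times> {t. size t \<le> n}))"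
  proof
    fix t :: shape assume "t \<in> {t. size t \<le> Suc n}"
    then show "t \<in> insert Tip (case_prod Bin ` ({t. size t \<le> n} \<times> {t. size t \<le> n}))"
      by (cases t) auto
  qed
  then show ?case
    by (rule finite_subset) (use Suc in simp)
qed

definition level :: "shape set \<Rightarrow> nat \<Rightarrow> nat \<Rightarrow> shape set" where
  "level A e n = {t \<in> A. excess t = e \<and> size t = n}"

lemma finite_level [simp]: "finite (level A e n)"
  by (rule finite_subset[OF _ finite_shapes_le[of n]]) (auto simp: level_def)

text \<open>The outer variable marks the excess, the inner one the size.\<close>

definition gf :: "shape set \<Rightarrow> real fps fps" where
  "gf A = Abs_fps (\<lambda>e. Abs_fps (\<lambda>n. real (card (level A e n))))"

lemma gf_nth [simp]: "gf A $ e $ n = real (card (level A e n))"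
  by (simp add: gf_def)

section \<open>Sum and product rules for the generating functions\<close>

lemma gf_Un:
  assumes "A \<inter> B = {}"
  shows "gf (A \<union> B) = gf A + gf B"
proof (intro fps_ext)
  fix e n
  have "level (A \<union> B) e n = level A e n \<union> level B e n" "level A e n \<inter> level B e n = {}"
    using assms by (auto simp: level_def)
  then show "gf (A \<union> B) $ e $ n = (gf A + gf B) $ e $ n"
    by (simp add: card_Un_disjoint)
qed

text \<open>Both statistics are additive, so sorting pairs by excess and size of the first component
  gives a double convolution.\<close>

lemma gf_product:
  assumes inj: "inj_on (case_prod f) (A \<times> B)"
    and size: "\<And>a b. a \<in> A \<Longrightarrow> b \<in> B \<Longrightarrow> size (f a b) = size a + size b"
    and excess: "\<And>a b. a \<in> A \<Longrightarrow> b \<in> B \<Longrightarrow> excess (f a b) = excess a + excess b"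
  shows "gf (case_prod f ` (A \<times> B)) = gf A * gf B"
proof (intro fps_ext)
  fix e n :: nat
  let ?I = "{0..e} \<times> {0..n}"
  let ?P = "\<lambda>(i, j). level A i j \<times> level B (e - i) (n - j)"
  have eq: "level (case_prod f ` (A \<times> B)) e n = case_prod f ` (\<Union>ij\<in>?I. ?P ij)"
  proof (intro equalityI subsetI)
    fix t assume "t \<in> level (case_prod f ` (A \<times> B)) e n"
    then obtain a b where ab: "a \<in> A" "b \<in> B" "t = f a b" "excess t = e" "size t = n"
      by (auto simp: level_def)
    then have "(a, b) \<in> ?P (excess a, size a)" "(excess a, size a) \<in> ?I"
      using size[of a b] excess[of a b] by (auto simp: level_def)
    then have "(a, b) \<in> (\<Union>ij\<in>?I. ?P ij)" by blast
    then show "t \<in> case_prod f ` (\<Union>ij\<in>?I. ?P ij)"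
      using ab(3) by (intro image_eqI[of _ _ "(a, b)"]) auto
  next
    fix t assume "t \<in> case_prod f ` (\<Union>ij\<in>?I. ?P ij)"
    then obtain i j a b where "i \<le> e" "j \<le> n" "a \<in> level A i j" "b \<in> level B (e - i) (n - j)" "t = f a b"
      by auto
    then show "t \<in> level (case_prod f ` (A \<times> B)) e n"
      using size[of a b] excess[of a b] by (auto simp: level_def)
  qed
  have "inj_on (case_prod f) (\<Union>ij\<in>?I. ?P ij)"
    by (rule inj_on_subset[OF inj]) (auto simp: level_def)
  then have "card (level (case_prod f ` (A \<times> B)) e n) = card (\<Union>ij\<in>?I. ?P ij)"
    unfolding eq by (rule card_image)
  also have "\<dots> = (\<Sum>ij\<in>?I. card (?P ij))"
  proof (rule card_UN_disjoint)
    show "\<forall>ij\<in>?I. \<forall>ij'\<in>?I. ij \<noteq> ij' \<longrightarrow> ?P ij \<inter> ?P ij' = {}"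
      by (auto simp: level_def)
  qed auto
  also have "\<dots> = (\<Sum>i=0..e. \<Sum>j=0..n. card (level A i j) * card (level B (e - i) (n - j)))"
    by (simp add: sum.cartesian_product card_cartesian_product case_prod_unfold)
  finally show "gf (case_prod f ` (A \<times> B)) $ e $ n = (gf A * gf B) $ e $ n"
    by (simp add: fps_mult_nth fps_sum_nth)
qed

section \<open>Functional equations for capped and uncapped trees\<close>

abbreviation "nonempty_shapes \<equiv> {t. t \<noteq> Tip}"
abbreviation "capped_shapes \<equiv> {t. capped t}"
abbreviation "uncapped_shapes \<equiv> {t. t \<noteq> Tip \<and> \<not> capped t}"

lemma gf_singleton: "gf {Bin Tip Tip} = fps_X\<^sup>2 * fps_const fps_X"
proof (intro fps_ext)
  fix e n
  have "level {Bin Tip Tip} e n = (if e = 2 \<and> n = 1 then {Bin Tip Tip} else {})"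
    by (auto simp: level_def excess_def)
  then show "gf {Bin Tip Tip} $ e $ n = (fps_X\<^sup>2 * fps_const fps_X :: real fps fps) $ e $ n"
    by (auto simp: fps_X_power_mult_nth fps_X_nth)
qed

lemma capped_not_Tip: "capped t \<Longrightarrow> t \<noteq> Tip"
  by auto

lemma gf_nonempty_split: "gf nonempty_shapes = gf capped_shapes + gf uncapped_shapes"
  by (subst gf_Un[symmetric]) (auto intro!: arg_cong[of _ _ gf] dest: capped_not_Tip)

text \<open>Only applied to capped trees, where the discarded right subtree is \<open>Tip\<close>.\<close>

fun graft :: "shape \<Rightarrow> shape \<Rightarrow> shape" where
  "graft Tip R = R"
| "graft (Bin L _) R = Bin L R"

lemma cappedE:
  assumes "capped t"
  obtains L where "L \<noteq> Tip" "t = Bin L Tip"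
  using assms by (cases t) auto

text \<open>An uncapped tree is a single node, a node with only a right subtree, or a node with two
  nonempty subtrees. The last kind is the capped tree \<open>Bin L Tip\<close> grafted with
  \<open>R\<close>, for which size and excess add up.\<close>

lemma gf_uncapped_shapes:
  "gf uncapped_shapes = gf {Bin Tip Tip} + gf {Bin Tip Tip} * gf nonempty_shapes + gf capped_shapes * gf nonempty_shapes"
proof -
  let ?U = "{Bin Tip Tip}"
  let ?A = "case_prod (\<lambda>_. Bin Tip) ` (?U \<times> nonempty_shapes)"
  let ?B = "case_prod graft ` (capped_shapes \<times> nonempty_shapes)"
  have B: "?B = {t. \<exists>L R. L \<noteq> Tip \<and> R \<noteq> Tip \<and> t = Bin L R}"
  proof (intro equalityI subsetI)
    fix t assume "t \<in> {t. \<exists>L R. L \<noteq> Tip \<and> R \<noteq> Tip \<and> t = Bin L R}"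
    then obtain L R where "L \<noteq> Tip" "R \<noteq> Tip" "t = Bin L R" by auto
    then show "t \<in> ?B"
      by (intro image_eqI[of _ _ "(Bin L Tip, R)"]) auto
  qed (auto elim!: cappedE)
  have "uncapped_shapes = ?U \<union> ?A \<union> ?B"
  proof (intro equalityI subsetI)
    fix t assume "t \<in> uncapped_shapes"
    then show "t \<in> ?U \<union> ?A \<union> ?B" unfolding B by (cases t) auto
  next
    fix t assume "t \<in> ?U \<union> ?A \<union> ?B"
    then show "t \<in> uncapped_shapes" unfolding B by auto
  qed
  moreover have "(?U \<union> ?A) \<inter> ?B = {}" "?U \<inter> ?A = {}"
    unfolding B by auto
  ultimately have "gf uncapped_shapes = gf ?U + gf ?A + gf ?B"
    by (simp only: gf_Un)
  also have "gf ?A = gf ?U * gf nonempty_shapes"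
    by (rule gf_product) (auto simp: inj_on_def excess_Tip_Bin excess_Tip_Bin[of Tip] excess_def[of Tip])
  also have "gf ?B = gf capped_shapes * gf nonempty_shapes"
    by (rule gf_product) (auto simp: inj_on_def excess_Bin elim!: cappedE)
  finally show ?thesis .
qed

text \<open>Remove the root. Above a capped subtree it acts as a factor for one node; above an
  uncapped one it lowers the excess by 1, and the factor \<open>fps_X\<close> on both sides avoids a
  negative power.\<close>

lemma gf_capped_shapes:
  "fps_X * gf capped_shapes = fps_X * gf {Bin Tip Tip} * gf capped_shapes + fps_const fps_X * gf uncapped_shapes"
proof -
  let ?U = "{Bin Tip Tip}"
  let ?A = "case_prod (\<lambda>_ L. Bin L Tip) ` (?U \<times> capped_shapes)"
  let ?B = "(\<lambda>L. Bin L Tip) ` uncapped_shapes"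
  have "capped_shapes = ?A \<union> ?B"
  proof (intro equalityI subsetI)
    fix t assume "t \<in> capped_shapes"
    then obtain L where "L \<noteq> Tip" "t = Bin L Tip" by (auto elim: cappedE)
    then show "t \<in> ?A \<union> ?B" by (cases "capped L") auto
  qed (auto dest: capped_not_Tip)
  moreover have "?A \<inter> ?B = {}" by auto
  ultimately have "gf capped_shapes = gf ?A + gf ?B"
    using gf_Un[of ?A ?B] by simp
  also have "gf ?A = gf ?U * gf capped_shapes"
  proof (rule gf_product)
    fix a b assume "a \<in> ?U" "b \<in> capped_shapes"
    then show "excess (Bin b Tip) = excess a + excess b"
      using excess_Bin_Tip[of b] excess_Tip_Bin[of Tip] capped_not_Tip[of b] by (auto simp: excess_def[of Tip])
  qed (auto simp: inj_on_def)
  finally have "fps_X * gf capped_shapes = fps_X * (gf ?U * gf capped_shapes + gf ?B)"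
    by simp
  moreover have "fps_X * gf ?B = fps_const fps_X * gf uncapped_shapes"
  proof (intro fps_ext)
    fix e n
    have lev: "level ?B e n = (if n = 0 then {} else (\<lambda>L. Bin L Tip) ` level uncapped_shapes (Suc e) (n - 1))" for e n
      using excess_Bin_Tip by (force simp: level_def)
    have "inj (\<lambda>L. Bin L Tip)" by (rule injI) simp
    then have "card (level ?B e n) = (if n = 0 then 0 else card (level uncapped_shapes (Suc e) (n - 1)))" for e n
      unfolding lev by (simp add: card_image inj_on_subset[of _ UNIV])
    \<comment> \<open>Settles outer index 0, where the left-hand side vanishes.\<close>
    moreover have "level uncapped_shapes 0 n = {}" for n
      using excess_Bin_Tip by (force simp: level_def)
    ultimately show "(fps_X * gf ?B) $ e $ n = (fps_const fps_X * gf uncapped_shapes) $ e $ n"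
      by (cases e) auto
  qed
  ultimately show ?thesis
    by (simp add: algebra_simps)
qed

text \<open>Compare coefficients of the outer variable. Level \<open>e\<close> of \<open>G\<close>
  involves level \<open>e + 1\<close> of \<open>H\<close>, but \<open>H\<close> at that level needs
  only levels up to \<open>e\<close>, because levels 0 of \<open>D\<close> and \<open>G\<close>
  vanish. Eliminating \<open>G\<close> and \<open>H\<close> leaves equations in
  \<open>D\<close>.\<close>

lemma gf_nonempty_levels:
  defines "D \<equiv> gf nonempty_shapes"
  shows "D $ 1 = fps_X\<^sup>2 + fps_X * (D $ 1)\<^sup>2"
    and "D $ 2 = fps_X + fps_X\<^sup>2 * D $ 1 + 2 * fps_X * D $ 1 * D $ 2"
    and "D $ 3 = 2 * fps_X * D $ 1 + fps_X\<^sup>2 * D $ 2 + fps_X * (2 * D $ 1 * D $ 3 + (D $ 2)\<^sup>2)"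
proof -
  define G where "G = gf capped_shapes"
  define H where "H = gf uncapped_shapes"
  define x :: "real fps" where "x = fps_X"
  have D: "D $ e = G $ e + H $ e" for e
    by (simp add: D_def G_def H_def gf_nonempty_split)
  have Heq: "H = fps_X\<^sup>2 * fps_const x + fps_X\<^sup>2 * (fps_const x * D) + G * D"
    using gf_uncapped_shapes by (simp add: D_def G_def H_def x_def gf_singleton mult.assoc)
  have H: "H $ e = (if e = 2 then x else 0) + (if e < 2 then 0 else x * D $ (e - 2)) + (\<Sum>i=0..e. G $ i * D $ (e - i))" for e
    unfolding Heq by (simp add: fps_X_power_mult_nth fps_mult_nth[of G])
  have "fps_X * G = fps_X ^ 3 * (fps_const x * G) + fps_const x * H"
    using gf_capped_shapes
    by (simp add: D_def G_def H_def x_def gf_singleton power3_eq_cube power2_eq_square mult.assoc)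
  then have "(fps_X * G) $ Suc e = (fps_X ^ 3 * (fps_const x * G) + fps_const x * H) $ Suc e" for e
    by simp
  moreover have "(fps_X ^ 3 * (fps_const x * G)) $ Suc e = (if e < 2 then 0 else x * G $ (e - 2))" for e
    by (auto simp: fps_X_power_mult_nth)
  ultimately have G: "G $ e = (if e < 2 then 0 else x * G $ (e - 2)) + x * H $ Suc e" for e
    by simp
  \<comment> \<open>Nonempty trees have positive excess.\<close>
  have D0: "D $ 0 = 0"
  proof (rule fps_ext)
    fix n
    have "level nonempty_shapes 0 n = {}"
      using boxes_bound by (fastforce simp: level_def excess_def split: if_splits)
    then show "D $ 0 $ n = 0 $ n"
      by (simp add: D_def)
  qed
  have H0: "H $ 0 = 0" and "G $ 0 = 0"
    using H[of 0] D[of 0] D0 by simp_all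
  then have G0: "G $ 0 = 0" by simp
  have H1: "H $ 1 = 0"
    using H[of 1] by (simp add: D0 G0)
  have G1: "G $ Suc 0 = D $ Suc 0" using D[of 1] H1 by simp
  have H2: "H $ 2 = x + (D $ 1)\<^sup>2"
    using H[of 2] by (simp add: D0 G0 G1 numeral_2_eq_2 power2_eq_square)
  have xH2: "x * H $ 2 = D $ 1"
    using G[of 1] by (simp add: G1 numeral_2_eq_2)
  have H3: "H $ 3 = x * D $ 1 + D $ 1 * D $ 2 + G $ 2 * D $ 1"
    using H[of 3] by (simp add: D0 G0 G1 numeral_2_eq_2 numeral_3_eq_3)
  have xH3: "x * H $ 3 = G $ 2"
    using G[of 2] by (simp add: G0 numeral_2_eq_2 numeral_3_eq_3)
  have H4: "H $ 4 = x * D $ 2 + D $ 1 * D $ 3 + G $ 2 * D $ 2 + G $ 3 * D $ 1"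
    using H[of 4] by (simp add: D0 G0 G1 eval_nat_numeral)
  have G3: "G $ 3 = x * D $ 1 + x * H $ 4"
    using G[of 3] by (simp add: G1 eval_nat_numeral)
  have G2: "G $ 2 = D $ 2 - H $ 2" using D[of 2] by simp
  show "D $ 1 = fps_X\<^sup>2 + fps_X * (D $ 1)\<^sup>2"
    using xH2 unfolding H2 x_def[symmetric] by (simp add: power2_eq_square algebra_simps)
  have "D $ 2 = x * H $ 3 + H $ 2"
    using D[of 2] xH3 by simp
  also have "\<dots> = x * (x * D $ 1 + 2 * D $ 1 * D $ 2) - (x * H $ 2) * D $ 1 + H $ 2"
    unfolding H3 G2 by (simp add: algebra_simps)
  \<comment> \<open>By \<open>xH2\<close> the subtracted term is the square of \<open>D $ 1\<close>,
    which cancels the one in \<open>H $ 2\<close>.\<close>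
  also have "\<dots> = x + x\<^sup>2 * D $ 1 + 2 * x * D $ 1 * D $ 2"
    unfolding xH2 by (simp add: H2 power2_eq_square algebra_simps)
  finally show "D $ 2 = fps_X + fps_X\<^sup>2 * D $ 1 + 2 * fps_X * D $ 1 * D $ 2"
    unfolding x_def .
  have G3': "G $ 3 = D $ 3 - H $ 3" using D[of 3] by simp
  have "D $ 3 = x * D $ 1 + x * H $ 4 + H $ 3"
    using D[of 3] G3 by simp
  also have "x * H $ 4 = x\<^sup>2 * D $ 2 + x * (2 * D $ 1 * D $ 3 + (D $ 2)\<^sup>2) - (x * H $ 2) * D $ 2 - (x * H $ 3) * D $ 1"
    unfolding H4 G2 G3' by (simp add: power2_eq_square algebra_simps)
  also have "\<dots> = x\<^sup>2 * D $ 2 + x * (2 * D $ 1 * D $ 3 + (D $ 2)\<^sup>2) - D $ 1 * D $ 2 - G $ 2 * D $ 1"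
    unfolding xH2 xH3 by simp
  \<comment> \<open>The two subtracted products cancel against those in \<open>H3\<close>, whose
    remaining \<open>x * D $ 1\<close> doubles the linear term.\<close>
  finally show "D $ 3 = 2 * fps_X * D $ 1 + fps_X\<^sup>2 * D $ 2 + fps_X * (2 * D $ 1 * D $ 3 + (D $ 2)\<^sup>2)"
    unfolding H3 x_def[symmetric] by (simp add: algebra_simps)
qed

lemma J_on_excess_three:
  assumes "i \<ge> 1"
  shows "8 * real (J (3 * i) (2 * i - 1)) =
    (8 + 9 * real i) * real ((2 * i) choose i) - 2 * real ((2 * (i - 1)) choose (i - 1))"
proof -
  \<comment> \<open>Here \<open>2 * (3 * i) - 3 * (2 * i - 1) = 3\<close>; conversely, excess 3 at
    this size forces the number of boxes.\<close>
  have "{t. size t = 3 * i \<and> boxes t = 2 * i - 1} = level nonempty_shapes 3 (3 * i)"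
    using assms by (auto simp: level_def excess_def)
  then have "real (J (3 * i) (2 * i - 1)) = gf nonempty_shapes $ 3 $ (3 * i)"
    by (simp add: J_eq_card_shapes)
  then show ?thesis
    using excess_three_coefficient[OF gf_nonempty_levels assms] by simp
qed

theorem theorem2p10:
  fixes i :: nat
  assumes "i \<ge> 1"
  shows "(i = 1 \<longrightarrow> J (3 * i) (2 * i - 1) = J 3 1 \<and> J 3 1 = 4) \<and>
         (i \<ge> 2 \<longrightarrow>
            real (J (3 * i) (2 * i - 1)) =
              real ((2 * i - 2) choose i) *
              ((9 * real i ^ 2 + 3 * real i - 4) / (2 * (real i - 1))))"
proof (intro conjI impI)
  show "J (3 * i) (2 * i - 1) = J 3 1" if "i = 1"
    using that by simp
  \<comment> \<open>The count reads \<open>8 * J 3 1 = 17 * 2 - 2 = 32\<close>.\<close>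
  show "J 3 1 = 4"
    using J_on_excess_three[of 1] by simp
  show "real (J (3 * i) (2 * i - 1)) =
      real ((2 * i - 2) choose i) * ((9 * real i ^ 2 + 3 * real i - 4) / (2 * (real i - 1)))"
    if "i \<ge> 2"
    using J_on_excess_three[OF assms] central_binomial_combination[OF that] by simp
qed

end
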